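(* Let $d\ge1$, $\mu>-\frac12$, $\beta>-d$ with $2\mu+\beta+d>0$, and $n\ge0$. The family of polynomials $\{\mathsf{U}^{\mathsf L}_{\mathbf k,n}:\mathbf k\in\mathbb{N}_0^d,\ |\mathbf k|\le n\}$ is a basis of $\mathcal{V}_n(\mathbb{V}^{d+1},W_{\beta,\mu})$.
   Context: $\mathbb{V}^{d+1}=\{(x,t):\|x\|\le t,\ x\in\mathbb{R}^d,\ 0\le t<\infty\}$ and $W_{\beta,\mu}(x,t)=(t^2-\|x\|^2)^{\mu-\frac12}t^\beta e^{-t}$. $\mathcal{V}_n(\mathbb{V}^{d+1},W_{\beta,\mu})$ is the space of polynomials of degree at most $n$ in $(x,t)$ orthogonal to all polynomials of degree at most $n-1$ with respect to $\langle f,g\rangle=\int_{\mathbb{V}^{d+1}}fg\,W_{\beta,\mu}\,dx\,dt$. For $\mathbf k\in\mathbb{N}_0^d$ with $|\mathbf k|=k_1+\cdots+k_d=k$, $0\le k\le n$, $$\mathsf{U}^{\mathsf L}_{\mathbf k,n}(x,t)=\frac{1}{W_{\beta,\mu}(x,t)}\,\frac{1}{t^{2k+2\mu+d-1}}\left[\frac{\partial^{\mathbf k}}{\partial x^{\mathbf k}}(t^2-\|x\|^2)^{k+\mu-\frac12}\right]\left[\frac{\partial^{n-k}}{\partial t^{n-k}}\bigl(t^{n+k+\beta+2\mu+d-1}e^{-t}\bigr)\right],$$ where $\frac{\partial^{\mathbf k}}{\partial x^{\mathbf k}}=\frac{\partial^{k}}{\partial x_1^{k_1}\cdots\partial x_d^{k_d}}$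 (this expression, defined for $\|x\|<t$, is a polynomial in $(x,t)$). *)

theory Defs
  imports "HOL-Analysis.Analysis" "HOL-Library.Function_Algebras"
begin

text \<open>
  The dimension \<open>d\<close> is \<open>CARD('d)\<close>. A point \<open>(x, t)\<close> has type \<open>(real^'d) \<times> real\<close>, a multi-index has
  type \<open>'d \<Rightarrow> nat\<close>, and polynomials in \<open>(x, t)\<close> are polynomial functions on the whole space.
\<close>

global_interpretation fun_space: vector_space "\<lambda>(c::real) (f::'a \<Rightarrow> real) z. c * f z"
  by unfold_locales (auto simp: fun_eq_iff algebra_simps)

definition mdeg :: "('d::finite \<Rightarrow> nat) \<Rightarrow> nat" where
  "mdeg k = (\<Sum>i\<in>UNIV. k i)"

definition monomial_fun :: "('d::finite \<Rightarrow> nat) \<Rightarrow> nat \<Rightarrow> (real^'d) \<times> real \<Rightarrow> real" where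
  "monomial_fun a j = (\<lambda>(x, t). (\<Prod>i\<in>UNIV. (x $ i) ^ a i) * t ^ j)"

definition polys_deg_le :: "nat \<Rightarrow> ((real^'d::finite) \<times> real \<Rightarrow> real) set" where
  "polys_deg_le n = fun_space.span {monomial_fun a j | a j. mdeg a + j \<le> n}"

definition solid_cone :: "((real^'d::finite) \<times> real) set" where
  "solid_cone = {(x, t). norm x \<le> t}"

definition weight :: "real \<Rightarrow> real \<Rightarrow> (real^'d::finite) \<times> real \<Rightarrow> real" where
  "weight \<beta> \<mu> = (\<lambda>(x, t). (t\<^sup>2 - (norm x)\<^sup>2) powr (\<mu> - 1/2) * t powr \<beta> * exp (- t))"

definition cone_inner ::
  "real \<Rightarrow> real \<Rightarrow> ((real^'d::finite) \<times> real \<Rightarrow> real) \<Rightarrow> ((real^'d) \<times> real \<Rightarrow> real) \<Rightarrow> real" where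
  "cone_inner \<beta> \<mu> f g = (LINT z:solid_cone|lborel. f z * g z * weight \<beta> \<mu> z)"

text \<open>
  Quantifying over all degrees \<open>m < n\<close> avoids the truncated \<open>n - 1\<close> at \<open>n = 0\<close>, where only the zero
  polynomial has degree at most \<open>-1\<close> and the orthogonality condition is void.
\<close>

definition orth_polys :: "real \<Rightarrow> real \<Rightarrow> nat \<Rightarrow> ((real^'d::finite) \<times> real \<Rightarrow> real) set" where
  "orth_polys \<beta> \<mu> n =
    {p \<in> polys_deg_le n. \<forall>m<n. \<forall>q \<in> polys_deg_le m. cone_inner \<beta> \<mu> p q = 0}"

definition partial_deriv :: "'d::finite \<Rightarrow> (real^'d \<Rightarrow> real) \<Rightarrow> real^'d \<Rightarrow> real" where
  "partial_deriv i f x = deriv (\<lambda>s. f (x + s *\<^sub>R axis i 1)) 0"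

text \<open>
  A type of class \<open>finite\<close> carries no canonical order, so one enumeration \<open>x\<^sub>1, \<dots>, x\<^sub>d\<close> of the
  coordinates is chosen. The choice is immaterial: mixed derivatives are only taken of functions
  that are smooth near the point in question, where partial derivatives commute.
\<close>

definition coords :: "'d::finite list" where
  "coords = (SOME is. distinct is \<and> set is = UNIV)"

definition mixed_deriv :: "('d::finite \<Rightarrow> nat) \<Rightarrow> (real^'d \<Rightarrow> real) \<Rightarrow> real^'d \<Rightarrow> real" where
  "mixed_deriv k f = foldr (\<lambda>i. partial_deriv i ^^ k i) coords f"

text \<open>The Rodrigues-type expression; meaningful for \<open>norm x < t\<close> and \<open>mdeg k \<le> n\<close> only.\<close>

definition UL_expr ::
  "real \<Rightarrow> real \<Rightarrow> ('d::finite \<Rightarrow> nat) \<Rightarrow> nat \<Rightarrow> (real^'d) \<times> real \<Rightarrow> real" where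
  "UL_expr \<beta> \<mu> k n = (\<lambda>(x, t).
     1 / weight \<beta> \<mu> (x, t)
     * (1 / t powr (2 * real (mdeg k) + 2 * \<mu> + real CARD('d) - 1))
     * mixed_deriv k (\<lambda>y. (t\<^sup>2 - (norm y)\<^sup>2) powr (real (mdeg k) + \<mu> - 1/2)) x
     * (deriv ^^ (n - mdeg k))
         (\<lambda>s. s powr (real n + real (mdeg k) + \<beta> + 2 * \<mu> + real CARD('d) - 1) * exp (- s)) t)"

text \<open>
  The polynomial given by the expression above. A polynomial is determined by its values on the
  nonempty open set \<open>norm x < t\<close>, so there is at most one.
\<close>

definition is_UL ::
  "real \<Rightarrow> real \<Rightarrow> ('d::finite \<Rightarrow> nat) \<Rightarrow> nat \<Rightarrow> ((real^'d) \<times> real \<Rightarrow> real) \<Rightarrow> bool" where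
  "is_UL \<beta> \<mu> k n p \<longleftrightarrow>
     real_polynomial_function p \<and> (\<forall>x t. norm x < t \<longrightarrow> p (x, t) = UL_expr \<beta> \<mu> k n (x, t))"

definition UL ::
  "real \<Rightarrow> real \<Rightarrow> ('d::finite \<Rightarrow> nat) \<Rightarrow> nat \<Rightarrow> (real^'d) \<times> real \<Rightarrow> real" where
  "UL \<beta> \<mu> k n = (THE p. is_UL \<beta> \<mu> k n p)"

end

theory Submission
  imports Defs
begin

text \<open>
  The expression factors as \<open>U\<^sub>k(x, t) = R\<^sub>k(x, t) q\<^sub>k(t)\<close> with \<open>R\<^sub>k\<close> homogeneous of degree \<open>\<bar>k\<bar>\<close> in
  \<open>(x, t)\<close> and \<open>q\<^sub>k\<close> a Laguerre polynomial of degree \<open>n - \<bar>k\<bar>\<close>. By homogeneity, the substitution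
  \<open>x = t y\<close> splits the inner product of \<open>U\<^sub>k\<close> with the monomial \<open>x\<^sup>a t\<^sup>j\<close> into a moment over the unit ball
  times a moment over the half line. Integrating by parts, the first vanishes unless \<open>k \<le> a\<close>
  pointwise, and is nonzero for \<open>a = k\<close>; given \<open>k \<le> a\<close>, the second vanishes if \<open>\<bar>a\<bar> + j < n\<close>, and is
  nonzero for \<open>\<bar>a\<bar> + j = n\<close>, \<open>a = k\<close>. Hence \<open>U\<^sub>k\<close> is orthogonal to lower degrees, and the matrix of the inner
  products of the \<open>U\<^sub>k\<close> with the monomials \<open>x\<^sup>a t\<^sup>n\<^sup>-\<^sup>\<bar>\<^sup>a\<^sup>\<bar>\<close> is triangular with respect to the degree, with
  nonzero diagonal. Triangularity gives independence; it also allows one to subtract from any \<open>p\<close> in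
  the orthogonal space a combination of the \<open>U\<^sub>k\<close> so that the difference is orthogonal to all
  polynomials of degree at most \<open>n\<close>, hence zero.
\<close>

section \<open>Homogeneous polynomials and the Rodrigues recursion\<close>

text \<open>Degree is counted jointly in \<open>x\<close> and \<open>t\<close>, so that dilations of
  the cone act by a power. As a span, each \<open>homog_polys n\<close> also contains the zero
  function.\<close>

definition homog_polys :: "nat \<Rightarrow> ((real^'d::finite) \<times> real \<Rightarrow> real) set" where
  "homog_polys n = fun_space.span {monomial_fun a j | a j. mdeg a + j = n}"

lemma monomial_fun_apply: "monomial_fun a j (x, t) = (\<Prod>i\<in>UNIV. (x $ i) ^ a i) * t ^ j"
  by (simp add: monomial_fun_def)

lemma monomial_fun_mult:
  "monomial_fun a j z * monomial_fun b l z = monomial_fun (\<lambda>i. a i + b i) (j + l) z"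
  by (cases z) (simp add: monomial_fun_def power_add prod.distrib)

lemma mdeg_add: "mdeg (\<lambda>i. a i + b i) = mdeg a + mdeg b"
  by (simp add: mdeg_def sum.distrib)

lemma monomial_fun_homog: "mdeg a + j = n \<Longrightarrow> monomial_fun a j \<in> homog_polys n"
  unfolding homog_polys_def by (rule fun_space.span_base) auto

lemma homog_polys_add:
  "p \<in> homog_polys n \<Longrightarrow> q \<in> homog_polys n \<Longrightarrow> (\<lambda>z. p z + q z) \<in> homog_polys n"
  using fun_space.span_add[of p _ q] unfolding homog_polys_def plus_fun_def by blast

lemma homog_polys_zero: "(\<lambda>z. 0) \<in> homog_polys n"
  using fun_space.span_zero unfolding homog_polys_def zero_fun_def by blast

lemma homog_polys_scale: "p \<in> homog_polys n \<Longrightarrow> (\<lambda>z. c * p z) \<in> homog_polys n"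
  using fun_space.span_scale unfolding homog_polys_def by blast

lemma homog_polys_diff:
  "p \<in> homog_polys n \<Longrightarrow> q \<in> homog_polys n \<Longrightarrow> (\<lambda>z. p z - q z) \<in> homog_polys n"
  using homog_polys_add[OF _ homog_polys_scale[of q n "-1"], of p] by simp

lemma homog_polys_sum:
  "finite I \<Longrightarrow> (\<And>i. i \<in> I \<Longrightarrow> p i \<in> homog_polys n) \<Longrightarrow> (\<lambda>z. \<Sum>i\<in>I. p i z) \<in> homog_polys n"
  by (induction I rule: finite_induct) (auto intro: homog_polys_zero homog_polys_add)

lemma homog_polys_induct [consumes 1, case_names zero monomial]:
  assumes "p \<in> homog_polys n" "P (\<lambda>z. 0)"
    and "\<And>c a j q. mdeg a + j = n \<Longrightarrow> q \<in> homog_polys n \<Longrightarrow> P q \<Longrightarrow> P (\<lambda>z. c * monomial_fun a j z + q z)"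
  shows "P p"
proof -
  have "p \<in> homog_polys n \<and> P p"
    using assms(1) unfolding homog_polys_def
  proof (induction rule: fun_space.span_induct_alt)
    case base
    then show ?case using assms(2) fun_space.span_zero by (auto simp: zero_fun_def)
  next
    case (step c x y)
    then obtain a j where x: "x = monomial_fun a j" "mdeg a + j = n" by blast
    have "(\<lambda>z. c * monomial_fun a j z + y z) \<in> homog_polys n"
      using x step by (intro homog_polys_add homog_polys_scale monomial_fun_homog) (auto simp: homog_polys_def)
    then show ?case
      using x assms(3)[of a j y c] step by (simp add: homog_polys_def plus_fun_def)
  qed
  then show ?thesis ..
qed

lemma homog_polys_mult:
  assumes "p \<in> homog_polys m" "q \<in> homog_polys n"
  shows "(\<lambda>z. p z * q z) \<in> homog_polys (m + n)"
  using assms(1)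
proof (induction rule: homog_polys_induct)
  case zero
  then show ?case by (simp add: homog_polys_zero)
next
  case (monomial c a j p)
  have "(\<lambda>z. monomial_fun a j z * q z) \<in> homog_polys (m + n)"
    using assms(2)
  proof (induction rule: homog_polys_induct)
    case zero
    then show ?case by (simp add: homog_polys_zero)
  next
    case (monomial c' a' j' q)
    have "(\<lambda>z. c' * monomial_fun (\<lambda>i. a i + a' i) (j + j') z + monomial_fun a j z * q z) \<in> homog_polys (m + n)"
      using monomial \<open>mdeg a + j = m\<close>
      by (intro homog_polys_add homog_polys_scale monomial_fun_homog) (auto simp: mdeg_add)
    then show ?case
      by (simp add: monomial_fun_mult[symmetric] algebra_simps)
  qed
  then have "(\<lambda>z. c * (monomial_fun a j z * q z) + p z * q z) \<in> homog_polys (m + n)"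
    using monomial by (intro homog_polys_add homog_polys_scale)
  then show ?case by (simp add: algebra_simps)
qed

lemma homog_polys_1: "(\<lambda>z. 1) \<in> homog_polys 0"
proof -
  have "monomial_fun (\<lambda>i. 0) 0 \<in> homog_polys 0"
    by (rule monomial_fun_homog) (simp add: mdeg_def)
  then show ?thesis by (simp add: monomial_fun_def case_prod_unfold)
qed

lemma homog_polys_t: "(\<lambda>z. snd z) \<in> homog_polys 1"
proof -
  have "monomial_fun (\<lambda>i. 0) 1 \<in> homog_polys 1"
    by (rule monomial_fun_homog) (simp add: mdeg_def)
  then show ?thesis by (simp add: monomial_fun_def case_prod_unfold)
qed

lemma homog_polys_x: "(\<lambda>z. fst z $ i) \<in> homog_polys 1"
proof -
  have "monomial_fun (\<lambda>l. if l = i then 1 else 0) 0 \<in> homog_polys 1"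
    by (rule monomial_fun_homog) (simp add: mdeg_def)
  moreover have "(\<Prod>l\<in>UNIV. (x $ l) ^ (if l = i then 1 else 0)) = x $ i" for x :: "real^'a"
    by (simp add: if_distrib[of "power _"] prod.delta cong: if_cong)
  ultimately show ?thesis by (simp add: monomial_fun_def case_prod_unfold)
qed

lemma homog_polys_power:
  "p \<in> homog_polys m \<Longrightarrow> (\<lambda>z. p z ^ j) \<in> homog_polys (m * j)"
  by (induction j) (auto intro: homog_polys_1 homog_polys_mult)

lemma homog_polys_quad:
  "(\<lambda>(x, t). t\<^sup>2 - (norm x)\<^sup>2) \<in> homog_polys 2"
proof -
  have "(\<lambda>z. snd z ^ 2 - (\<Sum>i\<in>UNIV. (fst z $ i) ^ 2)) \<in> homog_polys (1 * 2)"
    by (intro homog_polys_diff homog_polys_sum homog_polys_power homog_polys_x homog_polys_t) simp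
  then show ?thesis
    by (simp add: case_prod_unfold norm_vec_def L2_set_def sum_nonneg)
qed

text \<open>Checked on monomials and extended by linearity. This is what later separates the
  variables under the substitution x = t y.\<close>

lemma homog_polys_scaleR:
  "p \<in> homog_polys n \<Longrightarrow> p (c *\<^sub>R x, c * t) = c ^ n * p (x, t)"
proof (induction rule: homog_polys_induct)
  case (monomial b a j q)
  have "monomial_fun a j (c *\<^sub>R x, c * t) = c ^ n * monomial_fun a j (x, t)"
    using monomial(1)
    by (auto simp: monomial_fun_apply mdeg_def power_mult_distrib prod.distrib power_add power_sum)
  then show ?case using monomial by (simp add: algebra_simps)
qed simp

lemma real_polynomial_function_monomial_fun: "real_polynomial_function (monomial_fun a j)"
proof -
  have "real_polynomial_function (\<lambda>z. (\<Prod>i\<in>UNIV. (fst z $ i) ^ a i) * snd z ^ j)"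
    by (intro real_polynomial_function.intros(4) real_polynomial_function_prod
        real_polynomial_function_power real_polynomial_function.intros(1) bounded_linear_snd)
      (auto intro: bounded_linear_compose[OF bounded_linear_vec_nth bounded_linear_fst])
  then show ?thesis by (simp add: monomial_fun_def case_prod_unfold)
qed

lemma real_polynomial_function_homog:
  "p \<in> homog_polys n \<Longrightarrow> real_polynomial_function p"
  by (induction rule: homog_polys_induct)
    (intro real_polynomial_function.intros(2-4) real_polynomial_function_monomial_fun | assumption)+

lemma homog_polys_subset_polys_deg_le: "m \<le> n \<Longrightarrow> homog_polys m \<subseteq> polys_deg_le n"
  unfolding homog_polys_def polys_deg_le_def by (rule fun_space.span_mono) auto

lemma monomial_fun_has_derivative:
  "((\<lambda>s. monomial_fun a j (x + s *\<^sub>R axis i 1, t)) has_real_derivative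
     real (a i) * monomial_fun (a(i := a i - 1)) j (x, t)) (at 0)"
proof -
  define C where "C = (\<Prod>l\<in>-{i}. (x $ l) ^ a l) * t ^ j"
  have split: "monomial_fun b j (y, t) = (y $ i) ^ b i * ((\<Prod>l\<in>-{i}. (y $ l) ^ b l) * t ^ j)" for b y
    by (simp add: monomial_fun_apply prod.remove[of UNIV i] Compl_eq_Diff_UNIV)
  have 1: "monomial_fun a j (x + s *\<^sub>R axis i 1, t) = (x $ i + s) ^ a i * C" for s
    unfolding split C_def by (intro arg_cong2[of _ _ _ _ "(*)"] prod.cong) (auto simp: axis_def)
  have 2: "monomial_fun (a(i := a i - 1)) j (x, t) = (x $ i) ^ (a i - 1) * C"
    unfolding split C_def by (intro arg_cong2[of _ _ _ _ "(*)"] prod.cong) auto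
  show ?thesis
    unfolding 1 2 by (auto intro!: derivative_eq_intros)
qed

text \<open>Linearity reduces this to a monomial, whose exponent of x_i drops by one. For
  \<open>n = 0\<close> the truncated \<open>n - 1\<close> is 0 and membership alone would allow a
  nonzero constant, hence the separate conjunct on the zero derivative.\<close>

lemma homog_polys_partial_deriv:
  assumes "p \<in> homog_polys n"
  shows "\<exists>p' \<in> homog_polys (n - 1). (n = 0 \<longrightarrow> p' = (\<lambda>z. 0)) \<and>
     (\<forall>x t. ((\<lambda>s. p (x + s *\<^sub>R axis i 1, t)) has_real_derivative p' (x, t)) (at 0))"
  using assms
  proof (induction rule: homog_polys_induct)
    case zero
    then show ?case by (intro bexI[of _ "\<lambda>z. 0"]) (auto simp: homog_polys_zero)
  next
    case (monomial c a j q)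
    from monomial(3) obtain q' where q': "q' \<in> homog_polys (n - 1)" "n = 0 \<longrightarrow> q' = (\<lambda>z. 0)"
      "\<forall>x t. ((\<lambda>s. q (x + s *\<^sub>R axis i 1, t)) has_real_derivative q' (x, t)) (at 0)"
      by (elim bexE conjE)
    let ?p = "\<lambda>z. c * (real (a i) * monomial_fun (a(i := a i - 1)) j z) + q' z"
    have deg: "mdeg (a(i := a i - 1)) + j = n - 1" if "a i \<noteq> 0"
      using monomial(1) that by (simp add: mdeg_def sum.remove[of UNIV i])
    have "(\<lambda>z. real (a i) * monomial_fun (a(i := a i - 1)) j z) \<in> homog_polys (n - 1)"
      using deg by (cases "a i = 0") (auto intro: homog_polys_zero homog_polys_scale monomial_fun_homog)
    from homog_polys_add[OF homog_polys_scale[OF this, of c] q'(1)]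
    have "?p \<in> homog_polys (n - 1)" .
    moreover have "n = 0 \<longrightarrow> ?p = (\<lambda>z. 0)"
      using monomial(1) q' by (auto simp: mdeg_def)
    moreover have "\<forall>x t. ((\<lambda>s. c * monomial_fun a j (x + s *\<^sub>R axis i 1, t) + q (x + s *\<^sub>R axis i 1, t))
        has_real_derivative ?p (x, t)) (at 0)"
      using q'(3) by (intro allI DERIV_add DERIV_cmult monomial_fun_has_derivative) blast
    ultimately show ?case by (intro bexI[of _ ?p] conjI)
qed

text \<open>The polynomial factor of the Rodrigues formula. With Q = t^2 - |x|^2 and m derivatives
  already taken, differentiating Q^(\<sigma> - m) R in x_i and taking out Q^(\<sigma> - m - 1)
  leaves Q d_i R - 2 (\<sigma> - m) x_i R. The last letter of the word is differentiated
  first.\<close>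

fun rodrigues :: "real \<Rightarrow> 'd list \<Rightarrow> (real^'d::finite) \<times> real \<Rightarrow> real" where
  "rodrigues \<sigma> [] = (\<lambda>z. 1)"
| "rodrigues \<sigma> (i # L) = (\<lambda>(x, t). (t\<^sup>2 - (norm x)\<^sup>2) * partial_deriv i (\<lambda>y. rodrigues \<sigma> L (y, t)) x
     - 2 * (\<sigma> - real (length L)) * (x $ i) * rodrigues \<sigma> L (x, t))"

lemma rodrigues_homog: "rodrigues \<sigma> L \<in> homog_polys (length L)"
proof (induction L)
  case (Cons i L)
  obtain p' where p': "p' \<in> homog_polys (length L - 1)" "length L = 0 \<longrightarrow> p' = (\<lambda>z. 0)"
    "\<forall>x t. ((\<lambda>s. rodrigues \<sigma> L (x + s *\<^sub>R axis i 1, t)) has_real_derivative p' (x, t)) (at 0)"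
    using homog_polys_partial_deriv[OF Cons, of i] by (elim bexE conjE)
  have pd: "partial_deriv i (\<lambda>y. rodrigues \<sigma> L (y, t)) x = p' (x, t)" for x t
    unfolding partial_deriv_def by (rule DERIV_imp_deriv) (use p'(3) in blast)
  have 1: "(\<lambda>z. (case z of (x, t) \<Rightarrow> t\<^sup>2 - (norm x)\<^sup>2) * p' z) \<in> homog_polys (length (i # L))"
  \<comment> \<open>The degrees 2 and \<open>length L - 1\<close> add up to
    \<open>length L + 1\<close> only for nonempty \<open>L\<close>; for the empty word the
    derivative is zero.\<close>
  proof (cases "length L = 0")
    case True
    then show ?thesis using p' by (simp add: homog_polys_zero)
  next
    case False
    then show ?thesis using homog_polys_mult[OF homog_polys_quad p'(1)] by simp
  qed
  have "(\<lambda>z. fst z $ i * rodrigues \<sigma> L z) \<in> homog_polys (length (i # L))"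
    using homog_polys_mult[OF homog_polys_x Cons] by simp
  note 2 = homog_polys_diff[OF 1 homog_polys_scale[OF this, of "2 * (\<sigma> - real (length L))"]]
  have "rodrigues \<sigma> (i # L) = (\<lambda>z. (case z of (x, t) \<Rightarrow> t\<^sup>2 - (norm x)\<^sup>2) * p' z -
      2 * (\<sigma> - real (length L)) * (fst z $ i * rodrigues \<sigma> L z))"
    by (rule ext) (clarsimp simp: pd)
  then show ?case using 2 by (simp only:)
qed (simp add: homog_polys_1)

lemma rodrigues_partial_deriv:
  "((\<lambda>s. rodrigues \<sigma> L (x + s *\<^sub>R axis i 1, t)) has_real_derivative
     partial_deriv i (\<lambda>y. rodrigues \<sigma> L (y, t)) x) (at 0)"
proof -
  obtain p' where p': "p' \<in> homog_polys (length L - 1)" "length L = 0 \<longrightarrow> p' = (\<lambda>z. 0)"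
    "\<forall>x t. ((\<lambda>s. rodrigues \<sigma> L (x + s *\<^sub>R axis i 1, t)) has_real_derivative p' (x, t)) (at 0)"
    using homog_polys_partial_deriv[OF rodrigues_homog[of \<sigma> L], of i] by (elim bexE conjE)
  have "partial_deriv i (\<lambda>y. rodrigues \<sigma> L (y, t)) x = p' (x, t)"
    unfolding partial_deriv_def by (rule DERIV_imp_deriv) (use p'(3) in blast)
  then show ?thesis using p'(3) by simp
qed

lemma quad_has_derivative:
  "((\<lambda>s. t\<^sup>2 - (norm (x + s *\<^sub>R axis i 1))\<^sup>2) has_real_derivative - 2 * (x $ i)) (at 0)"
proof -
  have "(norm (x + s *\<^sub>R axis i 1))\<^sup>2 = (norm x)\<^sup>2 + 2 * (x $ i) * s + s\<^sup>2" for s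
    unfolding power2_norm_eq_inner
    by (simp add: inner_add_left inner_add_right inner_axis inner_axis' power2_eq_square algebra_simps)
  then show ?thesis by (auto intro!: derivative_eq_intros)
qed

text \<open>Induction over the word. The formula for \<open>L\<close> holds only for |y| < t, which
  suffices because this condition is open and a derivative depends only on values near the
  point.\<close>

lemma foldr_partial_deriv_quad_powr:
  assumes "norm x < t"
  shows "foldr partial_deriv L (\<lambda>y. (t\<^sup>2 - (norm y)\<^sup>2) powr \<sigma>) x =
    (t\<^sup>2 - (norm x)\<^sup>2) powr (\<sigma> - real (length L)) * rodrigues \<sigma> L (x, t)"
  using assms
proof (induction L arbitrary: x)
  case (Cons i L)
  let ?Q = "\<lambda>y. t\<^sup>2 - (norm y)\<^sup>2" and ?R = "rodrigues \<sigma> L" and ?\<kappa> = "\<sigma> - real (length L)"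
  let ?D = "partial_deriv i (\<lambda>y. ?R (y, t)) x"
  let ?y = "\<lambda>s. x + s *\<^sub>R axis i 1"
  have Qpos: "?Q x > 0" using Cons.prems by (simp add: power_strict_mono)
  have "((\<lambda>s. norm (?y s)) \<longlongrightarrow> norm (?y 0)) (at 0)" by (intro tendsto_intros)
  then have ev: "eventually (\<lambda>s. norm (?y s) < t) (at 0)"
    by (rule order_tendstoD(2)) (use Cons.prems in simp)
  have ev: "eventually (\<lambda>s. foldr partial_deriv L (\<lambda>y. ?Q y powr \<sigma>) (?y s) = ?Q (?y s) powr ?\<kappa> * ?R (?y s, t)) (nhds 0)"
    unfolding eventually_nhds_conv_at using Cons by (auto intro: eventually_mono[OF ev])
  have "((\<lambda>s. ?Q (?y s) powr ?\<kappa>) has_real_derivative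
      ?\<kappa> * ?Q x powr (?\<kappa> - 1) * (- 2 * x $ i)) (at 0)"
    using DERIV_fun_powr[OF quad_has_derivative[of t x i], of ?\<kappa>] Qpos by simp
  from DERIV_mult[OF this rodrigues_partial_deriv[of \<sigma> L x i t]]
  have "((\<lambda>s. ?Q (?y s) powr ?\<kappa> * ?R (?y s, t)) has_real_derivative
      (?\<kappa> * (?Q x powr (?\<kappa> - 1)) * (- 2 * x $ i)) * ?R (x, t) + ?D * ?Q x powr ?\<kappa>) (at 0)"
    by simp
  then have "foldr partial_deriv (i # L) (\<lambda>y. ?Q y powr \<sigma>) x
      = (?\<kappa> * (?Q x powr (?\<kappa> - 1)) * (- 2 * x $ i)) * ?R (x, t) + ?D * ?Q x powr ?\<kappa>"
    by (simp add: partial_deriv_def[of i "foldr _ _ _"] deriv_cong_ev[OF ev refl] DERIV_imp_deriv)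
  also have "?Q x powr ?\<kappa> = ?Q x powr (?\<kappa> - 1) * ?Q x"
    using Qpos by (simp add: powr_diff)
  finally show ?case by (simp add: algebra_simps)
qed simp

section \<open>Multi-indices as words in the coordinates\<close>

lemma coords_distinct: "distinct (coords :: 'd::finite list)"
  and set_coords: "set (coords :: 'd list) = UNIV"
  using someI_ex[of "\<lambda>xs::'d list. distinct xs \<and> set xs = UNIV"] finite_distinct_list[of "UNIV :: 'd set"]
  unfolding coords_def by auto

text \<open>Flattening a multi-index into one letter per derivative turns iterated powers of partial
  derivatives into a single fold, so that inductions proceed one derivative at a time.\<close>

definition coord_word :: "('d::finite \<Rightarrow> nat) \<Rightarrow> 'd list" where
  "coord_word k = concat (map (\<lambda>i. replicate (k i) i) coords)"

lemma mixed_deriv_coord_word: "mixed_deriv k f = foldr partial_deriv (coord_word k) f"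
proof -
  have rep: "foldr g (replicate n i) f = (g i ^^ n) f" for g :: "'b \<Rightarrow> 'c \<Rightarrow> 'c" and i n f
    by (induction n) auto
  have "foldr (\<lambda>i. partial_deriv i ^^ k i) xs f =
     foldr partial_deriv (concat (map (\<lambda>i. replicate (k i) i) xs)) f" for xs
    by (induction xs) (auto simp: rep)
  then show ?thesis by (simp add: mixed_deriv_def coord_word_def)
qed

lemma length_coord_word: "length (coord_word k) = mdeg k"
  using sum.distinct_set_conv_list[OF coords_distinct, of k]
  by (simp add: coord_word_def length_concat comp_def mdeg_def set_coords)

lemma count_list_coord_word:
  fixes k :: "'d::finite \<Rightarrow> nat"
  shows "count_list (coord_word k) = k"
proof
  fix i :: 'd
  have rep: "count_list (replicate n j) i = (if i = j then n else 0)" for n j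
    by (induction n) auto
  have "distinct xs \<Longrightarrow> count_list (concat (map (\<lambda>i. replicate (k i) i) xs)) i = (if i \<in> set xs then k i else 0)" for xs
    by (induction xs) (auto simp: rep)
  then show "count_list (coord_word k) i = k i"
    by (simp add: coord_word_def coords_distinct set_coords)
qed

lemma le_mdeg: "k i \<le> mdeg k"
  unfolding mdeg_def by (rule member_le_sum) auto

lemma finite_mdeg_le: "finite {k :: 'd::finite \<Rightarrow> nat. mdeg k \<le> n}"
proof (rule finite_subset)
  show "{k. mdeg k \<le> n} \<subseteq> {k. \<forall>i. (i \<in> (UNIV :: 'd set) \<longrightarrow> k i \<in> {..n}) \<and> (i \<notin> UNIV \<longrightarrow> k i = 0)}"
    using order.trans[OF le_mdeg] by auto
  show "finite {k. \<forall>i. (i \<in> (UNIV :: 'd set) \<longrightarrow> k i \<in> {..n}) \<and> (i \<notin> UNIV \<longrightarrow> k i = 0)}"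
    by (intro finite_set_of_finite_funs) auto
qed

lemma mdeg_mono: "(\<And>i. k i \<le> a i) \<Longrightarrow> mdeg k \<le> mdeg a"
  unfolding mdeg_def by (rule sum_mono) simp

text \<open>If k <= a held pointwise, distinct multi-indices would force |k| < |a|. This is the
  source of triangularity: a coordinate with \<open>a l < k l\<close> makes the ball moment
  vanish.\<close>

lemma ex_less_of_mdeg_le:
  assumes "mdeg a \<le> mdeg k" "a \<noteq> k"
  shows "\<exists>l. a l < k l"
proof (rule ccontr)
  assume "\<not> ?thesis"
  then have le: "k l \<le> a l" for l by (simp add: not_less)
  obtain l where "a l \<noteq> k l" using assms(2) by auto
  then have "k l < a l" using le[of l] by simp
  then have "mdeg k < mdeg a"
    unfolding mdeg_def using le by (intro sum_strict_mono_ex1) auto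
  then show False using assms(1) by simp
qed

lemma sum_fun_eq: "(\<Sum>i\<in>I. f i) = (\<lambda>z. \<Sum>i\<in>I. f i z)" for f :: "'i \<Rightarrow> 'a \<Rightarrow> 'b::comm_monoid_add"
  by (induction I rule: infinite_finite_induct) (auto simp: zero_fun_def plus_fun_def)

section \<open>Integrals over the unit ball\<close>

lemma nn_integral_lborel_scaleR:
  fixes f :: "'a::euclidean_space \<Rightarrow> ennreal"
  assumes [measurable]: "f \<in> borel_measurable borel" and c: "c > 0"
  shows "(\<integral>\<^sup>+x. f x \<partial>lborel) = ennreal (c ^ DIM('a)) * (\<integral>\<^sup>+x. f (c *\<^sub>R x) \<partial>lborel)"
  by (subst lborel_affine[of c 0])
    (use c in \<open>auto simp: nn_integral_density nn_integral_distr nn_integral_cmult\<close>)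

lemma lebesgue_integral_lborel_scaleR:
  fixes f :: "'a::euclidean_space \<Rightarrow> real"
  assumes [measurable]: "f \<in> borel_measurable borel" and c: "c > 0"
  shows "(\<integral>x. f x \<partial>lborel) = c ^ DIM('a) * (\<integral>x. f (c *\<^sub>R x) \<partial>lborel)"
  by (subst lborel_affine[of c 0])
    (use c in \<open>auto simp: integral_density integral_distr\<close>)

lemma borel_measurable_indicator_ball [measurable]:
  "(indicator (ball c r) :: 'a::euclidean_space \<Rightarrow> real) \<in> borel_measurable borel"
  by (rule borel_measurable_indicator) simp

text \<open>The factor \<open>t\<close> makes (t^2 - r^2)^(\<nu> + 1) / (2 (\<nu> + 1)) an explicit
  antiderivative. Since \<nu> may be negative, the integrand can blow up at \<open>t = r\<close>, so
  only the antiderivative is required to be continuous up to the ends. For \<open>r > 1\<close> both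
  sides are zero.\<close>

lemma nn_integral_shifted_power_le:
  fixes r \<nu> :: real
  assumes "\<nu> > -1" "r \<ge> 0"
  shows "(\<integral>\<^sup>+t. ennreal (indicator {r<..<1} t * (t * (t\<^sup>2 - r\<^sup>2) powr \<nu>)) \<partial>lborel)
    \<le> ennreal (indicator {..1} r / (2 * (\<nu> + 1)))"
proof (cases "r \<le> 1")
  case False
  then show ?thesis by (simp add: indicator_def)
next
  case True
  define F where "F = (\<lambda>t. (t\<^sup>2 - r\<^sup>2) powr (\<nu> + 1) / (2 * (\<nu> + 1)))"
  have "((\<lambda>t. t * (t\<^sup>2 - r\<^sup>2) powr \<nu>) has_integral (F 1 - F r)) {r..1}"
  proof (rule fundamental_theorem_of_calculus_interior[OF True])
    show "continuous_on {r..1} F"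
      unfolding F_def using assms by (intro continuous_intros continuous_on_powr') auto
    fix t assume "t \<in> {r<..<1}"
    then have pos: "t\<^sup>2 - r\<^sup>2 > 0" using assms by (simp add: power_strict_mono)
    have "((\<lambda>t. t\<^sup>2 - r\<^sup>2) has_real_derivative 2 * t) (at t)"
      by (auto intro!: derivative_eq_intros)
    from DERIV_fun_powr[OF this pos, of "\<nu> + 1"]
    have "((\<lambda>t. (t\<^sup>2 - r\<^sup>2) powr (\<nu> + 1)) has_real_derivative (2 * (\<nu> + 1)) * (t * (t\<^sup>2 - r\<^sup>2) powr \<nu>)) (at t)"
      by (simp add: algebra_simps)
    from DERIV_cdivide[OF this, of "2 * (\<nu> + 1)"]
    have "(F has_real_derivative t * (t\<^sup>2 - r\<^sup>2) powr \<nu>) (at t)"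
      unfolding F_def using assms by simp
    then show "(F has_vector_derivative t * (t\<^sup>2 - r\<^sup>2) powr \<nu>) (at t)"
      by (simp add: has_real_derivative_iff_has_vector_derivative)
  qed
  then have "(\<integral>\<^sup>+t. ennreal (indicator {r..1} t * (t * (t\<^sup>2 - r\<^sup>2) powr \<nu>)) \<partial>lborel) = ennreal (F 1 - F r)"
    using assms by (intro nn_integral_has_integral_lebesgue) auto
  moreover have "F 1 - F r \<le> 1 / (2 * (\<nu> + 1))"
  proof -
    have "r\<^sup>2 \<le> 1" using assms True by (simp add: power_le_one)
    then have "(1 - r\<^sup>2) powr (\<nu> + 1) \<le> 1 powr (\<nu> + 1)"
      using assms by (intro powr_mono2) auto
    then show ?thesis using assms by (auto simp: F_def divide_simps)
  qed
  moreover have "(\<integral>\<^sup>+t. ennreal (indicator {r<..<1} t * (t * (t\<^sup>2 - r\<^sup>2) powr \<nu>)) \<partial>lborel)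
      \<le> (\<integral>\<^sup>+t. ennreal (indicator {r..1} t * (t * (t\<^sup>2 - r\<^sup>2) powr \<nu>)) \<partial>lborel)"
    using assms by (intro nn_integral_mono ennreal_leI) (auto simp: indicator_def)
  ultimately show ?thesis
    using True by (auto intro: order_trans ennreal_leI)
qed

lemma quad_powr_scaleR:
  fixes y :: "'a::real_normed_vector" and t :: real
  assumes "t > 0" "norm y < 1"
  shows "(t\<^sup>2 - (norm (t *\<^sub>R y))\<^sup>2) powr \<nu> = t powr (2 * \<nu>) * (1 - (norm y)\<^sup>2) powr \<nu>"
proof -
  have "t\<^sup>2 - (norm (t *\<^sub>R y))\<^sup>2 = t powr 2 * (1 - (norm y)\<^sup>2)"
    using assms by (simp add: power_mult_distrib algebra_simps powr_numeral)
  moreover have "(norm y)\<^sup>2 < 1" using assms by (simp add: abs_square_less_1)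
  ultimately show ?thesis
    by (simp only: powr_mult powr_powr)
qed

text \<open>Integrating \<open>t (t\<^sup>2 - \<bar>x\<bar>\<^sup>2)\<^sup>\<nu>\<close> over \<open>\<bar>x\<bar> < t < 1\<close> in \<open>t\<close> first gives a finite value; by scaling,
  in \<open>x\<close> first it gives a positive multiple of the integral over the ball.\<close>
lemma nn_integral_ball_weight_finite:
  fixes \<nu> :: real
  assumes "\<nu> > -1"
  shows "(\<integral>\<^sup>+y. ennreal (indicator (ball 0 1) y * (1 - (norm y)\<^sup>2) powr \<nu>) \<partial>(lborel :: 'a::euclidean_space measure)) < \<infinity>"
    (is "?c < \<infinity>")
proof -
  define H where "H = (\<lambda>(x::'a, t::real). ennreal (indicator {norm x<..<1} t * (t * (t\<^sup>2 - (norm x)\<^sup>2) powr \<nu>)))"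
  have H_eq: "H = (\<lambda>z. ennreal ((if norm (fst z) < snd z \<and> snd z < 1 then 1 else 0) * (snd z * ((snd z)\<^sup>2 - (norm (fst z))\<^sup>2) powr \<nu>)))"
    by (auto simp: H_def fun_eq_iff indicator_def)
  have [measurable]: "H \<in> borel_measurable (lborel \<Otimes>\<^sub>M lborel)"
    unfolding H_eq by measurable
  define w where "w = (\<lambda>t::real. ennreal (indicator {0<..<1} t * t powr (1 + 2 * \<nu> + real DIM('a))))"
  have [measurable]: "w \<in> borel_measurable borel" unfolding w_def by measurable
  have scale: "(\<integral>\<^sup>+x. H (x, t) \<partial>lborel) = w t * ?c" for t
  proof (cases "0 < t \<and> t < 1")
    case True
    have m: "(\<lambda>x. H (x, t)) \<in> borel_measurable borel" unfolding H_eq by measurable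
    have "(\<integral>\<^sup>+x. H (x, t) \<partial>lborel) = ennreal (t ^ DIM('a)) * (\<integral>\<^sup>+x. H (t *\<^sub>R x, t) \<partial>lborel)"
      using True by (intro nn_integral_lborel_scaleR m) auto
    also have "(\<integral>\<^sup>+x. H (t *\<^sub>R x, t) \<partial>lborel) = (\<integral>\<^sup>+x. ennreal (t powr (1 + 2 * \<nu>)) *
        ennreal (indicator (ball (0::'a) 1) x * (1 - (norm x)\<^sup>2) powr \<nu>) \<partial>lborel)"
    proof (intro nn_integral_cong)
      fix x :: 'a
      have "t * (t\<^sup>2 - (norm (t *\<^sub>R x))\<^sup>2) powr \<nu> = t powr (1 + 2 * \<nu>) * (1 - (norm x)\<^sup>2) powr \<nu>" if "norm x < 1"
        using quad_powr_scaleR[of t x \<nu>] that True by (simp add: powr_add)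
      moreover have "norm (t *\<^sub>R x) < t \<longleftrightarrow> norm x < 1" using True by simp
      ultimately show "H (t *\<^sub>R x, t) = ennreal (t powr (1 + 2 * \<nu>)) *
          ennreal (indicator (ball 0 1) x * (1 - (norm x)\<^sup>2) powr \<nu>)"
        using True by (auto simp: H_def indicator_def ennreal_mult[symmetric])
    qed
    also have "\<dots> = ennreal (t powr (1 + 2 * \<nu>)) * ?c"
      by (intro nn_integral_cmult) measurable
    finally show ?thesis using True
      by (simp add: w_def powr_add powr_realpow ennreal_mult mult_ac)
  next
    case False
    then have "H (x, t) = 0" for x
      by (auto simp: H_def indicator_def dest: le_less_trans[OF norm_ge_zero])
    then show ?thesis using False by (auto simp: w_def indicator_def)
  qed
  have "integral\<^sup>N lborel w * ?c = (\<integral>\<^sup>+t. (\<integral>\<^sup>+x. H (x, t) \<partial>lborel) \<partial>lborel)"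
    by (simp add: scale nn_integral_multc)
  also have "\<dots> = (\<integral>\<^sup>+x. (\<integral>\<^sup>+t. H (x, t) \<partial>lborel) \<partial>lborel)"
    by (rule lborel_pair.Fubini) measurable
  also have "\<dots> \<le> (\<integral>\<^sup>+x. ennreal (1 / (2 * (\<nu> + 1))) * indicator (cball (0::'a) 1) x \<partial>lborel)"
  proof (intro nn_integral_mono)
    fix x :: 'a
    show "(\<integral>\<^sup>+t. H (x, t) \<partial>lborel) \<le> ennreal (1 / (2 * (\<nu> + 1))) * indicator (cball (0::'a) 1) x"
      using nn_integral_shifted_power_le[OF assms, of "norm x"]
      by (auto simp: H_def indicator_def split: if_splits)
  qed
  also have "\<dots> < \<infinity>"
    by (simp add: nn_integral_cmult_indicator ennreal_mult_less_top emeasure_bounded_finite[OF bounded_cball, simplified])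
  finally have fin: "integral\<^sup>N lborel w * ?c < \<infinity>" .
  \<comment> \<open>Finiteness of the product bounds \<open>?c\<close> only if the other factor is
    nonzero, as 0 times infinity is 0 in \<open>ennreal\<close>; \<open>w\<close> is positive on the
    open unit interval.\<close>
  have "integral\<^sup>N lborel w \<noteq> 0"
  proof
    assume "integral\<^sup>N lborel w = 0"
    then have "AE t in lborel. w t = 0" by (simp add: nn_integral_0_iff_AE)
    then have "AE t in lborel. t \<notin> {0<..<1::real}" by eventually_elim (auto simp: w_def)
    then have "{0<..<1::real} \<in> null_sets lborel" by (subst AE_iff_null_sets) auto
    then have "emeasure lborel {0<..<1::real} = 0" by (rule null_setsD1)
    then show False by (simp only: emeasure_lborel_Ioo) simp
  qed
  then show ?thesis
    using fin by (auto simp: ennreal_mult_less_top)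
qed

text \<open>A continuous \<open>G\<close> is bounded on the compact closed ball, so a multiple of
  the weight itself dominates.\<close>

lemma integrable_ball_weight:
  fixes G :: "'a::euclidean_space \<Rightarrow> real"
  assumes "\<nu> > -1" and G: "continuous_on UNIV G"
  shows "integrable lborel (\<lambda>y. indicator (ball 0 1) y * (G y * (1 - (norm y)\<^sup>2) powr \<nu>))"
proof -
  have [measurable]: "G \<in> borel_measurable borel" by (rule borel_measurable_continuous_onI[OF G])
  have "compact (G ` cball 0 1)"
    by (intro compact_continuous_image continuous_on_subset[OF G]) auto
  then obtain B where B: "\<And>y. y \<in> cball 0 1 \<Longrightarrow> norm (G y) \<le> B"
    by (metis compact_imp_bounded bounded_iff imageI)
  have "integrable lborel (\<lambda>y::'a. indicator (ball 0 1) y * (1 - (norm y)\<^sup>2) powr \<nu>)"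
    using nn_integral_ball_weight_finite[OF assms(1), where 'a = 'a]
    by (intro integrableI_bounded) (measurable, auto simp: abs_mult)
  then have "integrable lborel (\<lambda>y::'a. B * (indicator (ball 0 1) y * (1 - (norm y)\<^sup>2) powr \<nu>))"
    by simp
  then show ?thesis
  proof (rule Bochner_Integration.integrable_bound)
    show "AE y in lborel. norm (indicator (ball 0 1) y * (G y * (1 - (norm y)\<^sup>2) powr \<nu>))
        \<le> norm (B * (indicator (ball 0 1) y * (1 - (norm y)\<^sup>2) powr \<nu>))"
    proof (intro AE_I2)
      fix y :: 'a
      show "norm (indicator (ball 0 1) y * (G y * (1 - (norm y)\<^sup>2) powr \<nu>))
        \<le> norm (B * (indicator (ball 0 1) y * (1 - (norm y)\<^sup>2) powr \<nu>))"
        using B[of y] by (cases "y \<in> ball 0 1") (auto simp: abs_mult intro!: mult_right_mono)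
    qed
  qed measurable
qed


text \<open>The identity \<open>\<integral> F(y + v) - F(y) dy = 0\<close>, written as an integral over the segment, avoids
  any boundary term; here \<open>F\<close> is \<open>g\<close> times the weight, extended by zero outside the ball.\<close>
lemma integral_ball_directional_deriv_eq_0:
  fixes g g' :: "'a::euclidean_space \<Rightarrow> real" and v :: 'a
  assumes \<nu>: "\<nu> > 0" and v: "v \<noteq> 0"
    and g: "continuous_on UNIV g" and g': "continuous_on UNIV g'"
    and deriv: "\<And>y. ((\<lambda>s. g (y + s *\<^sub>R v)) has_real_derivative g' y) (at 0)"
  shows "(\<integral>y. indicator (ball 0 1) y * (((1 - (norm y)\<^sup>2) * g' y - 2 * \<nu> * (y \<bullet> v) * g y) *
      (1 - (norm y)\<^sup>2) powr (\<nu> - 1)) \<partial>lborel) = 0"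
proof -
  \<comment> \<open>Cutting off with \<open>max 0\<close> gives the extension by zero; it is
    continuous across the sphere because \<nu> > 0.\<close>
  define F where "F = (\<lambda>y. g y * (max 0 (1 - (norm y)\<^sup>2)) powr \<nu>)"
  define F' where "F' = (\<lambda>y. indicator (ball 0 1) y * (((1 - (norm y)\<^sup>2) * g' y - 2 * \<nu> * (y \<bullet> v) * g y) *
      (1 - (norm y)\<^sup>2) powr (\<nu> - 1)))"
  have ball_iff: "(norm y)\<^sup>2 < 1 \<longleftrightarrow> norm y < 1" for y :: 'a
    by (simp add: abs_square_less_1)
  have F_eq: "F y = indicator (ball 0 1) y * (g y * (1 - (norm y)\<^sup>2) powr \<nu>)" for y
    using ball_iff[of y] by (auto simp: F_def indicator_def max_def)
  have F_int: "integrable lborel F"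
    unfolding F_eq[abs_def] using \<nu> by (intro integrable_ball_weight g) auto
  have F'_int: "integrable lborel F'"
    unfolding F'_def using \<nu> by (intro integrable_ball_weight continuous_intros g g') auto
  have F_cont: "continuous_on UNIV F"
    unfolding F_def using \<nu> by (intro continuous_intros g continuous_on_powr') auto
  \<comment> \<open>Off the sphere, \<open>F\<close> is locally either the differentiable product or
    identically zero. Nothing is claimed on the sphere, near which \<open>F'\<close> may be
    unbounded when \<nu> < 1.\<close>
  have dF: "((\<lambda>u. F (y + u *\<^sub>R v)) has_real_derivative F' (y + u *\<^sub>R v)) (at u)"
    if ne: "norm (y + u *\<^sub>R v) \<noteq> 1" for y u
  proof -
    let ?z = "\<lambda>s. (y + u *\<^sub>R v) + s *\<^sub>R v" and ?q = "\<lambda>z. 1 - (norm z)\<^sup>2"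
    have tend: "((\<lambda>s. norm (?z s)) \<longlongrightarrow> norm (?z 0)) (at 0)" by (intro tendsto_intros)
    have "((\<lambda>s. F (?z s)) has_real_derivative F' (?z 0)) (at 0)"
    proof (cases "norm (y + u *\<^sub>R v) < 1")
      case True
      have "((\<lambda>s. ?q (?z s)) has_real_derivative - 2 * (?z 0 \<bullet> v)) (at 0)"
      proof -
        define c b where "c = ?q (?z 0)" and "b = ?z 0 \<bullet> v"
        have eq: "?q (?z s) = c - 2 * b * s - (v \<bullet> v) * s\<^sup>2" for s
          unfolding power2_norm_eq_inner c_def b_def
          by (simp add: inner_add_left inner_add_right inner_commute power2_eq_square algebra_simps)
        show ?thesis unfolding eq b_def[symmetric] by (auto intro!: derivative_eq_intros)
      qed
      from DERIV_fun_powr[OF this, of \<nu>]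
      have "((\<lambda>s. ?q (?z s) powr \<nu>) has_real_derivative \<nu> * ?q (?z 0) powr (\<nu> - 1) * (- 2 * (?z 0 \<bullet> v))) (at 0)"
        using True by (simp add: ball_iff)
      from DERIV_mult[OF deriv[of "?z 0"] this]
      have "((\<lambda>s. g (?z s) * ?q (?z s) powr \<nu>) has_real_derivative
          g' (?z 0) * ?q (?z 0) powr \<nu> + \<nu> * ?q (?z 0) powr (\<nu> - 1) * (- 2 * (?z 0 \<bullet> v)) * g (?z 0)) (at 0)"
        by simp
      moreover have "g' (?z 0) * ?q (?z 0) powr \<nu> + \<nu> * ?q (?z 0) powr (\<nu> - 1) * (- 2 * (?z 0 \<bullet> v)) * g (?z 0) = F' (?z 0)"
      proof -
        have "?q (?z 0) > 0" using True by (simp add: ball_iff)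
        then have q: "?q (?z 0) powr \<nu> = ?q (?z 0) powr (\<nu> - 1) * ?q (?z 0)"
          by (simp add: powr_diff)
        show ?thesis
          unfolding q using True by (simp add: F'_def algebra_simps)
      qed
      ultimately have D: "((\<lambda>s. g (?z s) * ?q (?z s) powr \<nu>) has_real_derivative F' (?z 0)) (at 0)"
        by (rule DERIV_cong)
      have "\<forall>\<^sub>F s in at 0. norm (?z s) < 1"
        by (rule order_tendstoD(2)[OF tend]) (use True in simp)
      then have "\<forall>\<^sub>F s in nhds 0. norm (?z s) < 1"
        unfolding eventually_nhds_conv_at using True by simp
      then have ev: "\<forall>\<^sub>F s in nhds 0. F (?z s) = g (?z s) * ?q (?z s) powr \<nu>"
        by eventually_elim (simp add: F_eq)
      show ?thesis by (subst DERIV_cong_ev[OF refl ev refl]) (rule D)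
    next
      case False
      have "\<forall>\<^sub>F s in at 0. norm (?z s) > 1"
        by (rule order_tendstoD(1)[OF tend]) (use False ne in simp)
      then have "\<forall>\<^sub>F s in nhds 0. norm (?z s) > 1"
        unfolding eventually_nhds_conv_at using False ne by simp
      then have "\<forall>\<^sub>F s in nhds 0. F (?z s) = 0"
        by eventually_elim (simp add: F_eq)
      moreover have "F' (?z 0) = 0" using False by (simp add: F'_def)
      ultimately show ?thesis using DERIV_cong_ev[of 0 0 "\<lambda>s. F (?z s)" "\<lambda>s. 0"] by simp
    qed
    then have "((\<lambda>s. F (?z (- u + s))) has_real_derivative F' (y + u *\<^sub>R v)) (at u)"
      using DERIV_shift[of "\<lambda>s. F (?z s)" "F' (y + u *\<^sub>R v)" u "-u"] by (simp add: add.commute)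
    then show ?thesis by (simp add: algebra_simps)
  qed
  \<comment> \<open>Since \<open>v\<close> is nonzero, the line meets the sphere in the roots of a
    nonzero quadratic polynomial, so the exceptional set for the fundamental theorem is
    finite.\<close>
  have fin: "finite {u. norm (y + u *\<^sub>R v) = 1}" for y
  proof -
    have "norm (y + u *\<^sub>R v) = 1 \<longleftrightarrow> poly [:y \<bullet> y - 1, 2 * (y \<bullet> v), v \<bullet> v:] u = 0" for u
    proof -
      have "norm (y + u *\<^sub>R v) = 1 \<longleftrightarrow> (norm (y + u *\<^sub>R v))\<^sup>2 = 1"
        by (simp add: abs_square_eq_1)
      also have "(norm (y + u *\<^sub>R v))\<^sup>2 = poly [:y \<bullet> y - 1, 2 * (y \<bullet> v), v \<bullet> v:] u + 1"
        unfolding power2_norm_eq_inner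
        by (simp add: inner_add_left inner_add_right inner_commute algebra_simps)
      finally show ?thesis by (simp del: poly_pCons)
    qed
    moreover have "finite {u. poly [:y \<bullet> y - 1, 2 * (y \<bullet> v), v \<bullet> v:] u = 0}"
      by (rule poly_roots_finite) (use v in simp)
    ultimately show ?thesis by (simp only:)
  qed
  have ftc: "((\<lambda>u. F' (y + u *\<^sub>R v)) has_integral (F (y + v) - F y)) {0..1}" for y
  proof -
    have "((\<lambda>u. F' (y + u *\<^sub>R v)) has_integral (F (y + 1 *\<^sub>R v) - F (y + 0 *\<^sub>R v))) {0..1}"
    proof (rule fundamental_theorem_of_calculus_strong[OF fin[of y]])
      show "continuous_on {0..1} (\<lambda>u. F (y + u *\<^sub>R v))"
        by (intro continuous_on_compose2[OF F_cont] continuous_intros) auto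
    qed (use dF in \<open>auto simp: has_real_derivative_iff_has_vector_derivative\<close>)
    then show ?thesis by simp
  qed
  have trans: "(\<integral>y. h (y + c) \<partial>lborel) = (\<integral>y. h y \<partial>lborel)" "integrable lborel (\<lambda>y. h (y + c))"
    if "integrable lborel h" for h :: "'a \<Rightarrow> real" and c
  proof -
    have [measurable]: "h \<in> borel_measurable borel" using that by simp
    show "(\<integral>y. h (y + c) \<partial>lborel) = (\<integral>y. h y \<partial>lborel)"
      by (subst (2) lborel_distr_plus[of c, symmetric]) (simp add: integral_distr add.commute)
    have "integrable (distr lborel borel ((+) c)) h"
      using that by (simp add: lborel_distr_plus)
    then show "integrable lborel (\<lambda>y. h (y + c))"
      by (subst (asm) integrable_distr_eq) (auto simp: add.commute)
  qed
  \<comment> \<open>Fubini in both orders: integrating in \<open>u\<close> first gives F(y + v) -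
    F(y), whose integral is zero by translation invariance; integrating in \<open>y\<close> first
    gives the integral of \<open>F'\<close> for every \<open>u\<close> in the unit interval.\<close>
  define K where "K = (\<lambda>(u::real, y::'a). indicator {0..1} u * F' (y + u *\<^sub>R v))"
  have [measurable]: "F' \<in> borel_measurable borel" using F'_int by simp
  have K_int: "integrable (lborel \<Otimes>\<^sub>M lborel) K"
  proof (rule lborel_pair.Fubini_integrable)
    show "K \<in> borel_measurable (lborel \<Otimes>\<^sub>M lborel)"
      unfolding K_def by measurable
    have "(\<integral>y. norm (K (u, y)) \<partial>lborel) = indicator {0..1} u * (\<integral>y. \<bar>F' y\<bar> \<partial>lborel)" for u
      using trans(1)[of "\<lambda>y. \<bar>F' y\<bar>" "u *\<^sub>R v"] F'_int by (simp add: K_def abs_mult)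
    then show "integrable lborel (\<lambda>u. \<integral>y. norm (K (u, y)) \<partial>lborel)" by simp
    show "AE u in lborel. integrable lborel (\<lambda>y. K (u, y))"
      using trans(2)[OF F'_int] by (auto simp: K_def)
  qed
  have "AE y in lborel. integrable lborel (\<lambda>u. K (u, y))"
    using lborel_pair.AE_integrable_snd[of "\<lambda>u y. K (u, y)"] K_int by simp
  then have "AE y in lborel. (\<integral>u. K (u, y) \<partial>lborel) = F (y + v) - F y"
  proof eventually_elim
    case (elim y)
    \<comment> \<open>The fundamental theorem yields a gauge integral, Fubini a Lebesgue integral;
      uniqueness identifies the two wherever the slice is integrable.\<close>
    have "((\<lambda>u. K (u, y)) has_integral (\<integral>u. K (u, y) \<partial>lborel)) UNIV"
      by (rule has_integral_integral_lborel[OF elim])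
    moreover have "((\<lambda>u. if u \<in> {0..1} then F' (y + u *\<^sub>R v) else 0) has_integral (F (y + v) - F y)) UNIV"
      using ftc[of y] by (simp only: has_integral_restrict_UNIV)
    then have "((\<lambda>u. K (u, y)) has_integral (F (y + v) - F y)) UNIV"
      by (rule has_integral_eq[rotated]) (auto simp: K_def)
    ultimately show ?case by (rule has_integral_unique)
  qed
  then have "(\<integral>y. (\<integral>u. K (u, y) \<partial>lborel) \<partial>lborel) = (\<integral>y. F (y + v) - F y \<partial>lborel)"
    using lborel_pair.integrable_snd[of "\<lambda>u y. K (u, y)"] K_int F_int trans(2)[OF F_int, of v]
    by (intro integral_cong_AE) auto
  also have "\<dots> = 0"
    using F_int trans[OF F_int, of v] by simp
  finally have "(\<integral>y. (\<integral>u. K (u, y) \<partial>lborel) \<partial>lborel) = 0" .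
  moreover have "(\<integral>y. (\<integral>u. K (u, y) \<partial>lborel) \<partial>lborel) = (\<integral>u. (\<integral>y. K (u, y) \<partial>lborel) \<partial>lborel)"
    using lborel_pair.Fubini_integral[of "\<lambda>u y. K (u, y)"] K_int by simp
  moreover have "(\<integral>y. K (u, y) \<partial>lborel) = indicator {0..1} u * (\<integral>y. F' y \<partial>lborel)" for u
    using trans(1)[OF F'_int, of "u *\<^sub>R v"] by (simp add: K_def)
  ultimately show ?thesis by (simp add: F'_def)
qed

section \<open>Ball moments of the Rodrigues polynomials\<close>

lemma continuous_on_homog_slice:
  assumes "p \<in> homog_polys n"
  shows "continuous_on UNIV (\<lambda>y. p (y, 1))"
  using continuous_on_polymonial_function[OF real_polynomial_function_homog[OF assms, unfolded real_polynomial_function_eq], of UNIV]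
  by (rule continuous_on_compose2) (auto intro!: continuous_intros)

text \<open>The slice t = 1. For the word of k and \<sigma> = |k| + \<mu> - 1/2 the exponent of the
  weight is \<mu> - 1/2; shorter words carry larger exponents, as integration by parts produces
  them.\<close>

definition ball_moment :: "real \<Rightarrow> 'd list \<Rightarrow> ('d::finite \<Rightarrow> nat) \<Rightarrow> real" where
  "ball_moment \<sigma> L a = (\<integral>y. indicator (ball 0 1) y * (rodrigues \<sigma> L (y, 1) * monomial_fun a 0 (y, 1) *
     (1 - (norm y)\<^sup>2) powr (\<sigma> - real (length L))) \<partial>lborel)"

lemma integrable_ball_moment:
  assumes "\<sigma> - real (length L) > -1"
  shows "integrable lborel (\<lambda>y::real^'d::finite. indicator (ball 0 1) y * (rodrigues \<sigma> L (y, 1) * monomial_fun a 0 (y, 1) *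
     (1 - (norm y)\<^sup>2) powr (\<sigma> - real (length L))))"
  using assms
  by (intro integrable_ball_weight continuous_on_mult continuous_on_homog_slice[OF rodrigues_homog]
      continuous_on_homog_slice[OF monomial_fun_homog[OF refl]])

text \<open>Integration by parts: the derivative along x_i of R x^a Q^\<nu>, with Q = 1 - |y|^2,
  integrates to zero. The terms from R and Q combine into the next Rodrigues polynomial, and the
  term from x^a leaves the factor a_i. If \<open>a i = 0\<close>, that factor also makes the
  truncated \<open>a i - 1\<close> harmless.\<close>

lemma ball_moment_Cons:
  assumes "\<sigma> - real (length L) > 0"
  shows "ball_moment \<sigma> (i # L) a = - real (a i) * ball_moment \<sigma> L (a(i := a i - 1))"
proof -
  let ?\<nu> = "\<sigma> - real (length L)" and ?a' = "a(i := a i - 1)"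
  let ?R = "\<lambda>y. rodrigues \<sigma> L (y, 1)" and ?m = "\<lambda>y. monomial_fun a 0 (y, 1)"
  let ?R' = "\<lambda>y. partial_deriv i (\<lambda>x. rodrigues \<sigma> L (x, 1)) y" and ?m' = "\<lambda>y. real (a i) * monomial_fun ?a' 0 (y, 1)"
  let ?w = "\<lambda>y. 1 - (norm y)\<^sup>2"
  obtain p' where p': "p' \<in> homog_polys (length L - 1)" "length L = 0 \<longrightarrow> p' = (\<lambda>z. 0)"
    "\<forall>x t. ((\<lambda>s. rodrigues \<sigma> L (x + s *\<^sub>R axis i 1, t)) has_real_derivative p' (x, t)) (at 0)"
    using homog_polys_partial_deriv[OF rodrigues_homog[of \<sigma> L], of i] by (elim bexE conjE)
  have "?R' = (\<lambda>y. p' (y, 1))"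
    unfolding partial_deriv_def by (intro ext DERIV_imp_deriv) (use p'(3) in blast)
  then have R': "continuous_on UNIV ?R'" using continuous_on_homog_slice[OF p'(1)] by simp
  have m': "continuous_on UNIV ?m'"
    by (intro continuous_intros continuous_on_homog_slice[OF monomial_fun_homog[OF refl]])
  have m: "continuous_on UNIV ?m" by (intro continuous_on_homog_slice[OF monomial_fun_homog[OF refl]])
  have R: "continuous_on UNIV ?R" by (intro continuous_on_homog_slice[OF rodrigues_homog])
  have deriv: "((\<lambda>s. ?R (y + s *\<^sub>R axis i 1) * ?m (y + s *\<^sub>R axis i 1)) has_real_derivative
      (?R' y * ?m y + ?m' y * ?R y)) (at 0)" for y
    using DERIV_mult[OF rodrigues_partial_deriv[of \<sigma> L y i 1] monomial_fun_has_derivative[of a 0 y i 1]] by simp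
  have "0 = (\<integral>y. indicator (ball 0 1) y * ((?w y * (?R' y * ?m y + ?m' y * ?R y) - 2 * ?\<nu> * (y \<bullet> axis i 1) * (?R y * ?m y)) *
      ?w y powr (?\<nu> - 1)) \<partial>lborel)"
  proof (rule integral_ball_directional_deriv_eq_0[symmetric, where g = "\<lambda>y. ?R y * ?m y"])
    show "continuous_on UNIV (\<lambda>y. ?R' y * ?m y + ?m' y * ?R y)"
      by (intro continuous_on_add continuous_on_mult R R' m m')
    show "continuous_on UNIV (\<lambda>y. ?R y * ?m y)"
      by (intro continuous_on_mult R m)
  qed (use assms deriv in \<open>simp_all add: axis_eq_0_iff\<close>)
  also have "\<dots> = (\<integral>y. indicator (ball 0 1) y * (rodrigues \<sigma> (i # L) (y, 1) * ?m y * ?w y powr (\<sigma> - real (length (i # L))))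
      + real (a i) * (indicator (ball 0 1) y * (?R y * monomial_fun ?a' 0 (y, 1) * ?w y powr ?\<nu>)) \<partial>lborel)"
  proof (intro Bochner_Integration.integral_cong refl)
    fix y :: "real^'a"
    have w: "?w y powr ?\<nu> = ?w y * ?w y powr (?\<nu> - 1)" if "norm y < 1"
    proof -
      have "?w y > 0" using that by (simp add: abs_square_less_1)
      then show ?thesis by (simp add: powr_diff)
    qed
    have e: "\<sigma> - real (length (i # L)) = ?\<nu> - 1" by simp
    show "indicator (ball 0 1) y * ((?w y * (?R' y * ?m y + ?m' y * ?R y) - 2 * ?\<nu> * (y \<bullet> axis i 1) * (?R y * ?m y)) *
        ?w y powr (?\<nu> - 1)) = indicator (ball 0 1) y * (rodrigues \<sigma> (i # L) (y, 1) * ?m y * ?w y powr (\<sigma> - real (length (i # L))))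
      + real (a i) * (indicator (ball 0 1) y * (?R y * monomial_fun ?a' 0 (y, 1) * ?w y powr ?\<nu>))"
    proof (cases "norm y < 1")
      case True
      show ?thesis
        unfolding e w[OF True] using True by (simp add: inner_axis algebra_simps)
    qed simp
  qed
  also have "\<dots> = ball_moment \<sigma> (i # L) a + real (a i) * ball_moment \<sigma> L ?a'"
    unfolding ball_moment_def using assms integrable_ball_moment[of \<sigma> "i # L" a] integrable_ball_moment[of \<sigma> L ?a']
    by (subst Bochner_Integration.integral_add) auto
  finally show ?thesis by simp
qed

text \<open>Each letter \<open>i\<close> contributes the factor \<open>a i\<close> and lowers that
  exponent by one. A letter occurring more often than its exponent therefore meets the factor
  zero.\<close>

lemma ball_moment_eq_0:
  assumes "\<sigma> - real (length L) > -1" "a l < count_list L l"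
  shows "ball_moment \<sigma> L a = 0"
  using assms
proof (induction L arbitrary: a)
  case (Cons i L)
  have "a i = 0 \<or> (a(i := a i - 1)) l < count_list L l"
    using Cons.prems by (auto split: if_splits)
  then show ?case
    using Cons by (auto simp: ball_moment_Cons)
qed simp

text \<open>Here the exponents are used up exactly: every factor in the recursion is nonzero, and
  what remains is the integral of a positive function over the ball.\<close>

lemma ball_moment_neq_0:
  fixes L :: "'d::finite list"
  assumes "\<sigma> - real (length L) > -1"
  shows "ball_moment \<sigma> L (count_list L) \<noteq> 0"
  using assms
proof (induction L)
  case Nil
  let ?f = "\<lambda>y::real^'d. indicator (ball 0 1) y * (1 - (norm y)\<^sup>2) powr \<sigma>"
  have int: "integrable lborel ?f"
    using integrable_ball_weight[of \<sigma> "\<lambda>y. 1"] Nil by simp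
  have pos: "?f y \<ge> 0" for y by simp
  have "ball_moment \<sigma> ([] :: 'd list) (count_list []) = integral\<^sup>L lborel ?f"
    by (simp add: ball_moment_def monomial_fun_apply)
  moreover have "integral\<^sup>L lborel ?f \<noteq> 0"
  proof
    assume "integral\<^sup>L lborel ?f = 0"
    then have "AE y in lborel. ?f y = 0"
      using integral_nonneg_eq_0_iff_AE[OF int] pos by simp
    then have "AE y in lborel. y \<notin> ball (0::real^'d) 1"
    proof eventually_elim
      case (elim y)
      then show ?case using abs_square_less_1[of "norm y"] by auto
    qed
    then have "ball (0::real^'d) 1 \<in> null_sets lborel" by (subst AE_iff_null_sets) auto
    then have "measure lborel (ball (0::real^'d) 1) = 0" by (simp add: null_setsD1 measure_def)
    then show False using content_ball_pos[of 1 "0::real^'d"] by (simp add: content_ball_pos)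
  qed
  ultimately show ?case by (simp only: not_False_eq_True)
next
  case (Cons i L)
  have "(count_list (i # L))(i := count_list (i # L) i - 1) = count_list L" by auto
  then show ?case using Cons by (simp add: ball_moment_Cons del: count_list.simps(2)) simp
qed

section \<open>Laguerre polynomials\<close>

text \<open>The factor left after dividing the \<open>j\<close>-th derivative of t^a e^(-t) by t^(a
  - j) e^(-t); it equals j! times the classical Laguerre polynomial of degree j with parameter a -
  j.\<close>

fun laguerre_poly :: "real \<Rightarrow> nat \<Rightarrow> real poly" where
  "laguerre_poly a 0 = 1"
| "laguerre_poly a (Suc j) =
     pCons 0 (pderiv (laguerre_poly a j)) + [:a - real j, -1:] * laguerre_poly a j"

lemma degree_laguerre_poly: "degree (laguerre_poly a j) \<le> j"
proof (induction j)
  case (Suc j)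
  have "degree (pCons 0 (pderiv (laguerre_poly a j))) \<le> Suc j"
    using Suc by (intro order.trans[OF degree_pCons_le]) (simp add: degree_pderiv)
  moreover have "degree ([:a - real j, -1:] * laguerre_poly a j) \<le> Suc j"
    using Suc by (intro order.trans[OF degree_mult_le]) simp
  ultimately show ?case by (simp only: laguerre_poly.simps degree_add_le)
qed simp

lemma higher_deriv_powr_exp:
  assumes "t > 0"
  shows "(deriv ^^ j) (\<lambda>s. s powr a * exp (- s)) t =
    t powr (a - real j) * exp (- t) * poly (laguerre_poly a j) t"
  using assms
proof (induction j arbitrary: t)
  case (Suc j)
  let ?p = "laguerre_poly a j" and ?b = "a - real j"
  have ev: "\<forall>\<^sub>F s in nhds t. (deriv ^^ j) (\<lambda>s. s powr a * exp (- s)) s = s powr ?b * exp (- s) * poly ?p s"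
    using eventually_nhds_in_open[of "{0<..}" t] Suc by (auto elim!: eventually_mono)
  have "((\<lambda>s. s powr ?b * exp (- s) * poly ?p s) has_real_derivative
     (?b * t powr (?b - 1) * exp (- t) - t powr ?b * exp (- t)) * poly ?p t + poly (pderiv ?p) t * (t powr ?b * exp (- t))) (at t)"
    using Suc.prems
    by (intro DERIV_mult poly_DERIV) (auto intro!: derivative_eq_intros simp: field_simps)
  then have "(deriv ^^ Suc j) (\<lambda>s. s powr a * exp (- s)) t =
     (?b * t powr (?b - 1) * exp (- t) - t powr ?b * exp (- t)) * poly ?p t + poly (pderiv ?p) t * (t powr ?b * exp (- t))"
    by (simp add: deriv_cong_ev[OF ev refl] DERIV_imp_deriv)
  also have "t powr ?b = t powr (?b - 1) * t"
    using Suc.prems by (simp add: powr_diff)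
  finally show ?case by (simp add: algebra_simps)
qed simp

section \<open>Moments for the Gamma weight on the half line\<close>

definition gamma_moment :: "real \<Rightarrow> real poly \<Rightarrow> real" where
  "gamma_moment a p = (\<integral>t. indicator {0<..} t * (t powr a * (poly p t * exp (- t))) \<partial>lborel)"

lemma has_bochner_integral_Gamma:
  fixes a :: real
  assumes "a > -1"
  shows "has_bochner_integral lborel (\<lambda>t. indicator {0<..} t * (t powr a * exp (- t))) (Gamma (a + 1))"
proof (rule has_bochner_integral_nn_integral)
  have "(\<integral>\<^sup>+t. ennreal (indicator {0<..} t * (t powr a * exp (- t))) \<partial>lborel)
    = (\<integral>\<^sup>+t. ennreal (indicator {0..} t * t powr (a + 1 - 1) / exp t) \<partial>lborel)"
    by (intro nn_integral_cong) (auto simp: indicator_def exp_minus field_simps)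
  also have "\<dots> = Gamma (a + 1)"
    using assms by (intro Gamma_conv_nn_integral_real[symmetric]) simp
  finally show "(\<integral>\<^sup>+t. ennreal (indicator {0<..} t * (t powr a * exp (- t))) \<partial>lborel) = ennreal (Gamma (a + 1))" .
qed (use assms in \<open>auto intro: Gamma_real_nonneg\<close>)

lemma has_bochner_integral_gamma_moment_monom:
  fixes a :: real
  assumes "a > -1"
  shows "has_bochner_integral lborel (\<lambda>t. indicator {0<..} t * (t powr a * (poly (monom c i) t * exp (- t))))
    (c * Gamma (a + real i + 1))"
proof -
  have "has_bochner_integral lborel (\<lambda>t. c * (indicator {0<..} t * (t powr (a + real i) * exp (- t))))
      (c * Gamma (a + real i + 1))"
    using assms by (intro has_bochner_integral_mult_right has_bochner_integral_Gamma) auto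
  also have "(\<lambda>t. c * (indicator {0<..} t * (t powr (a + real i) * exp (- t)))) =
      (\<lambda>t. indicator {0<..} t * (t powr a * (poly (monom c i) t * exp (- t))))"
    by (auto simp: fun_eq_iff indicator_def powr_add powr_realpow poly_monom)
  finally show ?thesis .
qed

lemma integrable_gamma_moment:
  fixes a :: real
  assumes "a > -1"
  shows "integrable lborel (\<lambda>t. indicator {0<..} t * (t powr a * (poly p t * exp (- t))))"
proof -
  have eq: "indicator {0<..} t * (t powr a * (poly p t * exp (- t))) =
     (\<Sum>i\<le>degree p. indicator {0<..} t * (t powr a * (poly (monom (coeff p i) i) t * exp (- t))))" for t
    by (subst poly_as_sum_of_monoms[of p, symmetric])
      (simp only: poly_sum sum_distrib_left sum_distrib_right)
  show ?thesis
    unfolding eq by (intro Bochner_Integration.integrable_sum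
        integrable.intros[OF has_bochner_integral_gamma_moment_monom[OF assms]])
qed

lemma gamma_moment_monom: "a > -1 \<Longrightarrow> gamma_moment a (monom c i) = c * Gamma (a + real i + 1)"
  unfolding gamma_moment_def using has_bochner_integral_gamma_moment_monom by (simp add: has_bochner_integral_iff)

lemma gamma_moment_add: "a > -1 \<Longrightarrow> gamma_moment a (p + q) = gamma_moment a p + gamma_moment a q"
  unfolding gamma_moment_def
  by (subst Bochner_Integration.integral_add[symmetric])
    (auto intro: integrable_gamma_moment simp: distrib_left distrib_right)

lemma gamma_moment_smult: "gamma_moment a (smult c p) = c * gamma_moment a p"
proof -
  have "indicator {0<..} t * (t powr a * (poly (smult c p) t * exp (- t))) =
     c * (indicator {0<..} t * (t powr a * (poly p t * exp (- t))))" for t :: real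
    by simp
  then show ?thesis unfolding gamma_moment_def by (simp only: integral_mult_right_zero)
qed

lemma gamma_moment_monom_mult:
  "gamma_moment a (monom 1 m * p) = gamma_moment (a + real m) p"
  unfolding gamma_moment_def
  by (intro Bochner_Integration.integral_cong)
    (auto simp: indicator_def powr_add powr_realpow poly_monom)

text \<open>The integrand is the derivative of t^(a + 1) p(t) e^(-t). Limits at the ends are
  avoided: on monomials the claim is the functional equation Gamma(s + 1) = s Gamma(s), and
  linearity does the rest.\<close>

lemma gamma_moment_by_parts:
  fixes a :: real
  assumes "a > -1"
  shows "gamma_moment a (pCons 0 (pderiv p) + [:a + 1, -1:] * p) = 0"
proof -
  let ?D = "\<lambda>p. pCons 0 (pderiv p) + [:a + 1, -1:] * p"
  have monom: "gamma_moment a (?D (monom c i)) = 0" for c i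
  proof -
    have "?D (monom c i) = monom ((a + 1 + real i) * c) i + monom (- c) (Suc i)"
    proof -
      have "poly (?D (monom c i)) t = poly (monom ((a + 1 + real i) * c) i + monom (- c) (Suc i)) t" for t
        by (cases i) (simp_all add: pderiv_monom poly_monom algebra_simps del: monom_Suc)
      then show ?thesis by (simp only: poly_eq_poly_eq_iff[symmetric] fun_eq_iff simp_thms)
    qed
    moreover have "Gamma (a + real i + 1 + 1) = (a + real i + 1) * Gamma (a + real i + 1)"
      using assms by (intro Gamma_plus1) (auto simp: nonpos_Ints_def)
    ultimately show ?thesis
      using assms by (simp add: gamma_moment_add gamma_moment_monom algebra_simps)
  qed
  have "gamma_moment a (?D (\<Sum>i\<in>I. monom (coeff p i) i)) = 0" if "finite I" for I
    using that
  proof (induction I rule: finite_induct)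
    case empty
    then show ?case by (simp add: gamma_moment_def)
  next
    case (insert i I)
    have "?D (q + r) = ?D q + ?D r" for q r
    proof -
      have "poly (?D (q + r)) t = poly (?D q + ?D r) t" for t
        by (simp add: pderiv_add algebra_simps)
      then show ?thesis by (simp only: poly_eq_poly_eq_iff[symmetric] fun_eq_iff simp_thms)
    qed
    then show ?case
      using insert monom[of "coeff p i" i] by (simp add: gamma_moment_add[OF assms] del: mult_pCons_left)
  qed
  from this[of "{..degree p}"] show ?thesis by (simp only: poly_as_sum_of_monoms finite_atMost)
qed

text \<open>Integration by parts applied to t^m times the \<open>j\<close>-th polynomial: with
  parameter \<open>a - real (Suc j)\<close>, the product rule yields t^m times the next polynomial
  plus m t^m times the current one. The subtraction \<open>real m - 1\<close> is taken in the reals,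
  so \<open>m = 0\<close> is covered, with factor zero.\<close>

lemma gamma_moment_laguerre_Suc:
  fixes a :: real
  assumes "a - real j > 0"
  shows "gamma_moment (a - real (Suc j) + real m) (laguerre_poly a (Suc j)) =
    - real m * gamma_moment (a - real j + (real m - 1)) (laguerre_poly a j)"
proof -
  let ?b = "a - real (Suc j)" and ?p = "laguerre_poly a j"
  have b: "?b > -1" using assms by simp
  have "pCons 0 (pderiv (monom 1 m * ?p)) + [:?b + 1, -1:] * (monom 1 m * ?p) =
     monom 1 m * laguerre_poly a (Suc j) + smult (real m) (monom 1 m * ?p)"
  proof -
    have "poly (pCons 0 (pderiv (monom 1 m * ?p)) + [:?b + 1, -1:] * (monom 1 m * ?p)) t =
       poly (monom 1 m * laguerre_poly a (Suc j) + smult (real m) (monom 1 m * ?p)) t" for t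
      by (cases m) (simp_all add: pderiv_mult pderiv_monom poly_monom algebra_simps)
    then show ?thesis by (simp only: poly_eq_poly_eq_iff[symmetric] fun_eq_iff simp_thms)
  qed
  with gamma_moment_by_parts[OF b, of "monom 1 m * ?p"]
  have "gamma_moment ?b (monom 1 m * laguerre_poly a (Suc j) + smult (real m) (monom 1 m * ?p)) = 0"
    by (simp only:)
  then have "gamma_moment ?b (monom 1 m * laguerre_poly a (Suc j)) = - real m * gamma_moment ?b (monom 1 m * ?p)"
    by (simp only: gamma_moment_add[OF b] gamma_moment_smult)
  then have "gamma_moment (?b + real m) (laguerre_poly a (Suc j)) = - real m * gamma_moment (?b + real m) ?p"
    by (simp only: gamma_moment_monom_mult)
  moreover have "a - real j + (real m - 1) = ?b + real m" by simp
  ultimately show ?thesis by (simp only:)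
qed

text \<open>Every step lowers \<open>m\<close> and \<open>j\<close> together and contributes the
  factor \<open>m\<close>, so for \<open>m < j\<close> the factor zero is met before
  \<open>j\<close> is exhausted.\<close>

lemma gamma_moment_laguerre_eq_0:
  fixes a :: real
  assumes "a - real j > -1" "m < j"
  shows "gamma_moment (a - real j + real m) (laguerre_poly a j) = 0"
  using assms
proof (induction j arbitrary: m)
  case (Suc j)
  show ?case
  proof (cases m)
    case (Suc m')
    then show ?thesis
      using Suc.prems Suc.IH[of m'] by (subst gamma_moment_laguerre_Suc) auto
  qed (use Suc.prems in \<open>subst gamma_moment_laguerre_Suc, auto\<close>)
qed simp

text \<open>The borderline case \<open>m = j\<close> of the recursion: the moment parameter stays at
  \<open>a\<close>, and the value is (-1)^j j! Gamma(a + 1).\<close>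

lemma gamma_moment_laguerre_neq_0:
  fixes a :: real
  assumes "a - real j > -1"
  shows "gamma_moment a (laguerre_poly a j) \<noteq> 0"
  using assms
proof (induction j)
  case 0
  then have "gamma_moment a (laguerre_poly a 0) = Gamma (a + 1)"
    using gamma_moment_monom[of a 1 0] by (simp add: monom_0 pCons_one)
  moreover have "Gamma (a + 1) > 0" using 0 by (intro Gamma_real_pos) simp
  ultimately show ?case by (metis less_irrefl)
next
  case (Suc j)
  have "gamma_moment a (laguerre_poly a (Suc j)) = - real (Suc j) * gamma_moment a (laguerre_poly a j)"
    using gamma_moment_laguerre_Suc[of a j "Suc j"] Suc.prems by simp
  then show ?case using Suc by simp
qed

section \<open>The inner product on the cone\<close>

text \<open>Substituting x = t y on each slice produces t^d from the Jacobian and t^s from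
  homogeneity, so the slice integral is a constant times a function of \<open>t\<close>. The same
  computation for absolute values gives integrability, after which Fubini gives the value.\<close>

lemma cone_integral_factor:
  fixes G :: "'a::euclidean_space \<times> real \<Rightarrow> real" and h :: "real \<Rightarrow> real"
  assumes G_meas: "G \<in> borel_measurable borel" and [measurable]: "h \<in> borel_measurable borel"
    and hom: "\<And>t y. t > 0 \<Longrightarrow> norm y < 1 \<Longrightarrow> G (t *\<^sub>R y, t) = t powr s * G (y, 1)"
    and G_int: "integrable lborel (\<lambda>y. indicator (ball 0 1) y * G (y, 1))"
    and h_int: "integrable lborel (\<lambda>t. indicator {0<..} t * (t powr (s + real DIM('a)) * h t))"
  defines "F \<equiv> (\<lambda>z. (if norm (fst z) < snd z then G z * h (snd z) else 0))"
  shows "integrable lborel F" (is ?int)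
    and "integral\<^sup>L lborel F = (\<integral>y. indicator (ball 0 1) y * G (y, 1) \<partial>lborel) *
      (\<integral>t. indicator {0<..} t * (t powr (s + real DIM('a)) * h t) \<partial>lborel)" (is ?val)
proof -
  have [measurable]: "G \<in> borel_measurable (borel \<Otimes>\<^sub>M borel)"
    using G_meas by (simp add: borel_prod)
  have [measurable]: "F \<in> borel_measurable (lborel \<Otimes>\<^sub>M lborel)"
    unfolding F_def by measurable
  have F_slice [measurable]: "(\<lambda>x. F (x, t)) \<in> borel_measurable borel" for t
    unfolding F_def by measurable
  have F_scale: "F (t *\<^sub>R y, t) = (t powr s * h t) * (indicator (ball 0 1) y * G (y, 1))" if "t > 0" for t y
    using that hom[OF that, of y] by (auto simp: F_def indicator_def)
  have F_neg: "F (x, t) = 0" if "\<not> t > 0" for x t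
    using that by (auto simp: F_def dest: le_less_trans[OF norm_ge_zero])
  have pow: "t ^ DIM('a) * t powr s = t powr (s + real DIM('a))" if "t > 0" for t
    using that by (simp add: powr_add powr_realpow)
  let ?c = "\<integral>\<^sup>+y. ennreal \<bar>indicator (ball 0 1) y * G (y, 1)\<bar> \<partial>lborel"
  have slice_nn: "(\<integral>\<^sup>+x. ennreal \<bar>F (x, t)\<bar> \<partial>lborel)
      = ennreal \<bar>indicator {0<..} t * (t powr (s + real DIM('a)) * h t)\<bar> * ?c" for t
  proof (cases "t > 0")
    case True
    have "(\<integral>\<^sup>+x. ennreal \<bar>F (x, t)\<bar> \<partial>lborel) = ennreal (t ^ DIM('a)) * (\<integral>\<^sup>+y. ennreal \<bar>F (t *\<^sub>R y, t)\<bar> \<partial>lborel)"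
      using True by (intro nn_integral_lborel_scaleR) measurable
    also have "(\<integral>\<^sup>+y. ennreal \<bar>F (t *\<^sub>R y, t)\<bar> \<partial>lborel) = (\<integral>\<^sup>+y. ennreal \<bar>t powr s * h t\<bar> * ennreal \<bar>indicator (ball 0 1) y * G (y, 1)\<bar> \<partial>lborel)"
      by (simp only: F_scale[OF True] abs_mult[of "t powr s * h t"] ennreal_mult abs_ge_zero)
    also have "\<dots> = ennreal \<bar>t powr s * h t\<bar> * ?c"
      using G_int by (intro nn_integral_cmult) auto
    also have "ennreal (t ^ DIM('a)) * (ennreal \<bar>t powr s * h t\<bar> * ?c) = ennreal (t ^ DIM('a) * \<bar>t powr s * h t\<bar>) * ?c"
      using True by (simp add: ennreal_mult mult.assoc)
    also have "t ^ DIM('a) * \<bar>t powr s * h t\<bar> = \<bar>indicator {0<..} t * (t powr (s + real DIM('a)) * h t)\<bar>"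
      using True by (simp add: pow[symmetric] abs_mult)
    finally show ?thesis .
  next
    case False
    then show ?thesis by (simp add: F_neg)
  qed
  have slice: "(\<integral>x. F (x, t) \<partial>lborel) = (\<integral>y. indicator (ball 0 1) y * G (y, 1) \<partial>lborel) *
      (indicator {0<..} t * (t powr (s + real DIM('a)) * h t))" for t
  proof (cases "t > 0")
    case True
    have "(\<integral>x. F (x, t) \<partial>lborel) = t ^ DIM('a) * (\<integral>y. F (t *\<^sub>R y, t) \<partial>lborel)"
      using True by (intro lebesgue_integral_lborel_scaleR) measurable
    then show ?thesis using True by (simp add: F_scale pow[symmetric])
  next
    case False
    then show ?thesis by (simp add: F_neg)
  qed
  have F_int: "integrable (lborel \<Otimes>\<^sub>M lborel) F"
  proof (rule integrableI_bounded)
    have "(\<integral>\<^sup>+z. ennreal (norm (F z)) \<partial>(lborel \<Otimes>\<^sub>M lborel))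
      = (\<integral>\<^sup>+t. (\<integral>\<^sup>+x. ennreal \<bar>F (x, t)\<bar> \<partial>lborel) \<partial>lborel)"
      by (subst lborel_pair.nn_integral_snd[symmetric]) auto
    also have "\<dots> = (\<integral>\<^sup>+t. ennreal \<bar>indicator {0<..} t * (t powr (s + real DIM('a)) * h t)\<bar> \<partial>lborel) * ?c"
      unfolding slice_nn using h_int by (intro nn_integral_multc) auto
    also have "\<dots> < \<infinity>"
      using G_int h_int by (auto simp: integrable_iff_bounded ennreal_mult_less_top)
    finally show "(\<integral>\<^sup>+z. ennreal (norm (F z)) \<partial>(lborel \<Otimes>\<^sub>M lborel)) < \<infinity>" .
  qed measurable
  then show ?int by (simp add: lborel_prod)
  have "integral\<^sup>L lborel F = (\<integral>t. (\<integral>x. F (x, t) \<partial>lborel) \<partial>lborel)"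
    using lborel_pair.integral_snd[of "\<lambda>x t. F (x, t)"] F_int by (simp add: lborel_prod)
  then show ?val by (simp add: slice)
qed

text \<open>Restricted to the line from \<open>z0\<close> to \<open>z\<close>, the polynomial
  depends on a single variable and vanishes at all small positive parameters, hence identically; the
  parameter 1 is the point \<open>z\<close>.\<close>

lemma real_polynomial_function_eq_0:
  fixes p :: "'a::real_normed_vector \<Rightarrow> real"
  assumes p: "real_polynomial_function p" and S: "open S" "z0 \<in> S" "\<And>z. z \<in> S \<Longrightarrow> p z = 0"
  shows "p = (\<lambda>z. 0)"
proof
  fix z
  let ?l = "\<lambda>s::real. z0 + s *\<^sub>R (z - z0)"
  have l: "polynomial_function ?l"
    by (intro polynomial_function_add polynomial_function_const polynomial_function_bounded_linear
        bounded_linear_scaleR_left)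
  have "real_polynomial_function (p \<circ> ?l)"
    by (rule real_polynomial_function_compose[OF l p])
  then obtain a n where an: "p \<circ> ?l = (\<lambda>s. \<Sum>i\<le>n. a i * s ^ i)"
    using real_polynomial_function_imp_sum by blast
  define q where "q = (\<Sum>i\<le>n. monom (a i) i)"
  have q: "poly q s = p (?l s)" for s
    using fun_cong[OF an, of s] by (simp add: q_def poly_sum poly_monom)
  have "\<forall>\<^sub>F s in at_right 0. ?l s \<in> S"
  proof (rule topological_tendstoD[OF _ S(1)])
    show "(?l \<longlongrightarrow> ?l 0) (at_right 0)" by (intro tendsto_intros)
  qed (use S in simp)
  then obtain e where e: "e > 0" "\<And>s. 0 < s \<Longrightarrow> s < e \<Longrightarrow> ?l s \<in> S"
    unfolding eventually_at_right_field by blast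
  have "{0<..<e} \<subseteq> {s. poly q s = 0}"
    using e S(3) by (auto simp: q)
  moreover have "infinite {0<..<e}" using e(1) by (rule infinite_Ioo)
  ultimately have "q = 0" using poly_roots_finite[of q] finite_subset by blast
  then show "p z = 0" using q[of 1] by simp
qed

lemma open_cone_interior: "open {z::'a::real_normed_vector \<times> real. norm (fst z) < snd z}"
  by (intro open_Collect_less continuous_intros)

lemma polys_deg_le_real_polynomial:
  assumes "p \<in> polys_deg_le n"
  shows "real_polynomial_function p"
  using assms unfolding polys_deg_le_def
proof (induction rule: fun_space.span_induct_alt)
  case base
  then show ?case by (simp add: zero_fun_def real_polynomial_function.intros(2))
next
  case (step c x y)
  then have "real_polynomial_function (\<lambda>z. c * x z + y z)"
    by (auto intro!: real_polynomial_function.intros(2-4) real_polynomial_function_monomial_fun)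
  then show ?case by (simp add: plus_fun_def)
qed

lemma monomial_fun_polys_deg_le: "mdeg a + j \<le> n \<Longrightarrow> monomial_fun a j \<in> polys_deg_le n"
  unfolding polys_deg_le_def by (rule fun_space.span_base) auto

text \<open>In the cone |x| < t, so \<open>t\<close> alone controls the size. Using 1 + t instead of
  t makes powers increase with the exponent, so that the two terms of a sum can share
  \<open>N1 + N2\<close>.\<close>

lemma real_polynomial_function_cone_bound:
  fixes p :: "'a::real_normed_vector \<times> real \<Rightarrow> real"
  assumes "real_polynomial_function p"
  obtains C N where "C \<ge> 0" "\<And>x t. norm x < t \<Longrightarrow> \<bar>p (x, t)\<bar> \<le> C * (1 + t) ^ N"
proof -
  have "\<exists>C N. C \<ge> 0 \<and> (\<forall>x t. norm x < t \<longrightarrow> \<bar>p (x, t)\<bar> \<le> C * (1 + t) ^ N)"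
    using assms
  proof (induction rule: real_polynomial_function.induct)
    case (linear f)
    then obtain K where K: "K \<ge> 0" "\<And>z. norm (f z) \<le> norm z * K"
      using bounded_linear.nonneg_bounded by blast
    have "\<bar>f (x, t)\<bar> \<le> (2 * K) * (1 + t) ^ 1" if "norm x < t" for x t
    proof -
      have "t > 0" using that by (rule le_less_trans[OF norm_ge_zero])
      then have "norm (x, t) \<le> 2 * (1 + t)" using norm_Pair_le[of x t] that by simp
      then have "norm (x, t) * K \<le> 2 * (1 + t) * K" using K(1) by (rule mult_right_mono)
      then show ?thesis using K(2)[of "(x, t)"] by (simp add: algebra_simps)
    qed
    then show ?case using K(1) by (intro exI[of _ "2 * K"] exI[of _ 1]) auto
  next
    case (const c)
    show ?case by (intro exI[of _ "\<bar>c\<bar>"] exI[of _ 0]) auto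
  next
    case (add f g)
    then obtain C1 N1 C2 N2 where 1: "C1 \<ge> 0" "\<And>x t. norm x < t \<Longrightarrow> \<bar>f (x, t)\<bar> \<le> C1 * (1 + t) ^ N1"
      and 2: "C2 \<ge> 0" "\<And>x t. norm x < t \<Longrightarrow> \<bar>g (x, t)\<bar> \<le> C2 * (1 + t) ^ N2" by metis
    have "\<bar>f (x, t) + g (x, t)\<bar> \<le> (C1 + C2) * (1 + t) ^ (N1 + N2)" if "norm x < t" for x t
    proof -
      have "t > 0" using that by (rule le_less_trans[OF norm_ge_zero])
      then have "C1 * (1 + t) ^ N1 \<le> C1 * (1 + t) ^ (N1 + N2)" "C2 * (1 + t) ^ N2 \<le> C2 * (1 + t) ^ (N1 + N2)"
        using 1 2 by (auto intro!: mult_left_mono power_increasing)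
      then show ?thesis using 1(2)[OF that] 2(2)[OF that] by (simp add: distrib_right)
    qed
    then show ?case using 1(1) 2(1) by (intro exI[of _ "C1 + C2"] exI[of _ "N1 + N2"]) auto
  next
    case (mult f g)
    then obtain C1 N1 C2 N2 where 1: "C1 \<ge> 0" "\<And>x t. norm x < t \<Longrightarrow> \<bar>f (x, t)\<bar> \<le> C1 * (1 + t) ^ N1"
      and 2: "C2 \<ge> 0" "\<And>x t. norm x < t \<Longrightarrow> \<bar>g (x, t)\<bar> \<le> C2 * (1 + t) ^ N2" by metis
    have "\<bar>f (x, t) * g (x, t)\<bar> \<le> (C1 * C2) * (1 + t) ^ (N1 + N2)" if "norm x < t" for x t
    proof -
      have "\<bar>f (x, t)\<bar> * \<bar>g (x, t)\<bar> \<le> (C1 * (1 + t) ^ N1) * (C2 * (1 + t) ^ N2)"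
        using 1(2)[OF that] 2(2)[OF that] by (intro mult_mono) (auto intro: order.trans[OF abs_ge_zero])
      then show ?thesis by (simp add: abs_mult power_add mult_ac)
    qed
    then show ?case using 1(1) 2(1) by (intro exI[of _ "C1 * C2"] exI[of _ "N1 + N2"]) auto
  qed
  then show ?thesis using that by blast
qed

section \<open>The Rodrigues expression as a polynomial\<close>

definition cone_poly :: "real \<Rightarrow> real \<Rightarrow> ('d::finite \<Rightarrow> nat) \<Rightarrow> nat \<Rightarrow> (real^'d) \<times> real \<Rightarrow> real" where
  "cone_poly \<beta> \<mu> k n = (\<lambda>z. rodrigues (real (mdeg k) + \<mu> - 1/2) (coord_word k) z *
     poly (laguerre_poly (real n + real (mdeg k) + \<beta> + 2 * \<mu> + real CARD('d) - 1) (n - mdeg k)) (snd z))"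

text \<open>Expanding the Laguerre factor in powers of \<open>t\<close> gives homogeneous terms of
  degree |k| + i with i <= n - |k|.\<close>

lemma cone_poly_polys_deg_le:
  assumes "mdeg k \<le> n"
  shows "cone_poly \<beta> \<mu> k n \<in> polys_deg_le n"
proof -
  define q R where "q = laguerre_poly (real n + real (mdeg k) + \<beta> + 2 * \<mu> + real CARD('a) - 1) (n - mdeg k)"
    and "R = rodrigues (real (mdeg k) + \<mu> - 1/2) (coord_word k)"
  have R: "R \<in> homog_polys (mdeg k)"
    unfolding R_def length_coord_word[of k, symmetric] by (rule rodrigues_homog)
  have "(\<Sum>i\<le>degree q. (\<lambda>z. coeff q i * (R z * snd z ^ i))) \<in> polys_deg_le n"
    unfolding polys_deg_le_def
  proof (intro fun_space.span_sum fun_space.span_scale)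
    fix i assume "i \<in> {..degree q}"
    then have "mdeg k + i \<le> n"
      using assms degree_laguerre_poly[of _ "n - mdeg k"] unfolding q_def by (fastforce dest: order.trans)
    moreover have "(\<lambda>z. R z * snd z ^ i) \<in> homog_polys (mdeg k + i)"
      using homog_polys_mult[OF R homog_polys_power[OF homog_polys_t]] by simp
    ultimately show "(\<lambda>z. R z * snd z ^ i) \<in> fun_space.span {monomial_fun a j |a j. mdeg a + j \<le> n}"
      using homog_polys_subset_polys_deg_le unfolding polys_deg_le_def by blast
  qed
  also have "(\<Sum>i\<le>degree q. (\<lambda>z. coeff q i * (R z * snd z ^ i))) = cone_poly \<beta> \<mu> k n"
    unfolding sum_fun_eq cone_poly_def q_def[symmetric] R_def[symmetric] poly_altdef
    by (simp add: sum_distrib_left mult_ac)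
  finally show ?thesis .
qed

lemma real_polynomial_function_cone_poly:
  "mdeg k \<le> n \<Longrightarrow> real_polynomial_function (cone_poly \<beta> \<mu> k n)"
  using polys_deg_le_real_polynomial[OF cone_poly_polys_deg_le] .

text \<open>After n - |k| derivatives the exponent of \<open>t\<close> is \<beta> + (2|k| + 2\<mu> +
  d - 1): the weight cancels t^\<beta> e^(-t) and the prefactor the remaining power. The |k|
  derivatives in \<open>x\<close> leave the power \<mu> - 1/2 that the weight contains.\<close>

lemma cone_poly_eq_UL_expr:
  assumes "mdeg k \<le> n" "norm x < t"
  shows "cone_poly \<beta> \<mu> k n (x, t) = UL_expr \<beta> \<mu> k n (x, t)"
proof -
  have t: "t > 0" using assms(2) by (rule le_less_trans[OF norm_ge_zero])
  define Q where "Q = t\<^sup>2 - (norm x)\<^sup>2"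
  have Q: "Q > 0" using assms(2) by (simp add: Q_def power_strict_mono)
  define R q where "R = rodrigues (real (mdeg k) + \<mu> - 1/2) (coord_word k) (x, t)"
    and "q = poly (laguerre_poly (real n + real (mdeg k) + \<beta> + 2 * \<mu> + real CARD('a) - 1) (n - mdeg k)) t"
  let ?e = "2 * real (mdeg k) + 2 * \<mu> + real CARD('a) - 1"
  have 1: "mixed_deriv k (\<lambda>y. (t\<^sup>2 - (norm y)\<^sup>2) powr (real (mdeg k) + \<mu> - 1/2)) x = Q powr (\<mu> - 1/2) * R"
    unfolding mixed_deriv_coord_word using foldr_partial_deriv_quad_powr[OF assms(2)]
    by (simp add: length_coord_word Q_def R_def)
  have e: "real n + real (mdeg k) + \<beta> + 2 * \<mu> + real CARD('a) - 1 - real (n - mdeg k) = \<beta> + ?e"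
    using assms(1) by (simp add: of_nat_diff)
  have 2: "(deriv ^^ (n - mdeg k)) (\<lambda>s. s powr (real n + real (mdeg k) + \<beta> + 2 * \<mu> + real CARD('a) - 1) * exp (- s)) t
      = t powr \<beta> * t powr ?e * exp (- t) * q"
    unfolding higher_deriv_powr_exp[OF t] e by (simp add: q_def powr_add)
  have w: "weight \<beta> \<mu> (x, t) = Q powr (\<mu> - 1/2) * t powr \<beta> * exp (- t)"
    by (simp add: weight_def Q_def)
  have nz: "Q powr (\<mu> - 1/2) \<noteq> 0" "t powr \<beta> \<noteq> 0" "t powr ?e \<noteq> 0" using Q t by auto
  have "UL_expr \<beta> \<mu> k n (x, t) = 1 / (Q powr (\<mu> - 1/2) * t powr \<beta> * exp (- t)) * (1 / t powr ?e) *
      (Q powr (\<mu> - 1/2) * R) * (t powr \<beta> * t powr ?e * exp (- t) * q)"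
    unfolding UL_expr_def prod.case 1 2 w ..
  also have "\<dots> = R * q"
    using nz by (simp add: field_simps)
  finally show ?thesis by (simp add: cone_poly_def R_def q_def)
qed

lemma is_UL_cone_poly: "mdeg k \<le> n \<Longrightarrow> is_UL \<beta> \<mu> k n (cone_poly \<beta> \<mu> k n)"
  by (simp add: is_UL_def real_polynomial_function_cone_poly cone_poly_eq_UL_expr)

text \<open>The definite description needs uniqueness: two polynomials agreeing on the open set |x|
  < t agree everywhere.\<close>

lemma UL_eq_cone_poly:
  fixes k :: "'d::finite \<Rightarrow> nat"
  assumes "mdeg k \<le> n"
  shows "UL \<beta> \<mu> k n = cone_poly \<beta> \<mu> k n"
  unfolding UL_def
proof (rule the_equality)
  show "is_UL \<beta> \<mu> k n (cone_poly \<beta> \<mu> k n)" using assms by (rule is_UL_cone_poly)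
  fix p :: "(real^'d) \<times> real \<Rightarrow> real" assume p: "is_UL \<beta> \<mu> k n p"
  have "(\<lambda>z. p z - cone_poly \<beta> \<mu> k n z) = (\<lambda>z. 0)"
  proof (rule real_polynomial_function_eq_0[OF _ open_cone_interior])
    show "(0, 1) \<in> {z::(real^'d) \<times> real. norm (fst z) < snd z}" by simp
    show "real_polynomial_function (\<lambda>z. p z - cone_poly \<beta> \<mu> k n z)"
      using p is_UL_cone_poly[OF assms] by (intro real_polynomial_function_diff) (auto simp: is_UL_def)
  qed (use p is_UL_cone_poly[OF assms, of \<beta> \<mu>] in \<open>auto simp: is_UL_def\<close>)
  then show "p = cone_poly \<beta> \<mu> k n" by (simp add: fun_eq_iff)
qed

section \<open>Convergence and factorization of the inner product\<close>

lemma weight_boundary: "norm x = t \<Longrightarrow> weight \<beta> \<mu> (x, t) = 0"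
  by (auto simp: weight_def)

text \<open>Passing to the open cone is exact: \<open>powr\<close> with base zero is zero for every
  exponent, so the boundary contributes nothing pointwise, even for \<mu> < 1/2, where the weight is
  singular there.\<close>

lemma cone_inner_altdef:
  "cone_inner \<beta> \<mu> f g = (\<integral>z. (if norm (fst z) < snd z then f z * g z * weight \<beta> \<mu> z else 0) \<partial>lborel)"
  unfolding cone_inner_def set_lebesgue_integral_def
  by (intro Bochner_Integration.integral_cong)
    (auto simp: solid_cone_def indicator_def weight_boundary split: prod.splits)

lemma borel_measurable_quad_powr [measurable]:
  "(\<lambda>z::'a::euclidean_space \<times> real. ((snd z)\<^sup>2 - (norm (fst z))\<^sup>2) powr \<nu>) \<in> borel_measurable borel"
  by (intro powr_real_measurable borel_measurable_continuous_onI continuous_intros)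

text \<open>The polynomial is dominated by a function of \<open>t\<close> alone, and that bound
  times the weight factors into ball and half line.\<close>

lemma integrable_polynomial_weight:
  fixes p :: "(real^'d::finite) \<times> real \<Rightarrow> real"
  assumes \<mu>: "\<mu> > -1/2" and \<beta>: "2 * \<mu> + \<beta> + real CARD('d) > 0" and p: "real_polynomial_function p"
  shows "integrable lborel (\<lambda>z. if norm (fst z) < snd z then p z * weight \<beta> \<mu> z else 0)"
proof -
  obtain C N where C: "C \<ge> 0" "\<And>x t. norm x < t \<Longrightarrow> \<bar>p (x, t)\<bar> \<le> C * (1 + t) ^ N"
    using real_polynomial_function_cone_bound[OF p] by blast
  define G where "G = (\<lambda>z::(real^'d) \<times> real. ((snd z)\<^sup>2 - (norm (fst z))\<^sup>2) powr (\<mu> - 1/2))"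
  define h where "h = (\<lambda>t::real. C * (1 + t) ^ N * t powr \<beta> * exp (- t))"
  have "integrable lborel (\<lambda>z::(real^'d) \<times> real. if norm (fst z) < snd z then G z * h (snd z) else 0)"
  proof (rule cone_integral_factor(1))
    show "G \<in> borel_measurable borel" unfolding G_def by measurable
    show "h \<in> borel_measurable borel" unfolding h_def by measurable
    show "G (t *\<^sub>R y, t) = t powr (2 * (\<mu> - 1/2)) * G (y, 1)" if "t > 0" "norm y < 1" for t y
      using quad_powr_scaleR[OF that] by (simp add: G_def)
    show "integrable lborel (\<lambda>y::real^'d. indicator (ball 0 1) y * G (y, 1))"
      using integrable_ball_weight[of "\<mu> - 1/2" "\<lambda>y::real^'d. 1"] \<mu> by (simp add: G_def)
    \<comment> \<open>The exponent 2\<mu> - 1 + d + \<beta> exceeds -1 exactly when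
      \<open>2 * \<mu> + \<beta> + real CARD('d) > 0\<close>. The polynomial is C (1 + t)^N.\<close>
    have "integrable lborel (\<lambda>t. indicator {0<..} t * (t powr (2 * (\<mu> - 1/2) + real DIM(real^'d) + \<beta>) *
        (poly (smult C ([:1, 1:] ^ N)) t * exp (- t))))"
      using \<beta> by (intro integrable_gamma_moment) simp
    then show "integrable lborel (\<lambda>t. indicator {0<..} t * (t powr (2 * (\<mu> - 1/2) + real DIM(real^'d)) * h t))"
      by (rule Bochner_Integration.integrable_cong[THEN iffD1, rotated 2])
        (auto simp: h_def powr_add indicator_def)
  qed
  then show ?thesis
  proof (rule Bochner_Integration.integrable_bound)
    have "p \<in> borel_measurable borel"
      using p by (intro borel_measurable_continuous_onI continuous_on_polymonial_function)
        (simp add: real_polynomial_function_eq)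
    moreover have "weight \<beta> \<mu> \<in> borel_measurable (borel :: ((real^'d) \<times> real) measure)"
      unfolding weight_def case_prod_unfold
      by (intro borel_measurable_times borel_measurable_quad_powr powr_real_measurable
          borel_measurable_continuous_onI continuous_intros)
    moreover have "{z::(real^'d) \<times> real. norm (fst z) < snd z} \<in> sets borel"
      using open_cone_interior by (rule borel_open)
    ultimately show "(\<lambda>z. if norm (fst z) < snd z then p z * weight \<beta> \<mu> z else 0) \<in> borel_measurable lborel"
      by (intro measurable_If) auto
    show "AE z in lborel. norm (if norm (fst z) < snd z then p z * weight \<beta> \<mu> z else 0)
        \<le> norm (if norm (fst z) < snd z then G z * h (snd z) else 0)"
    proof (intro AE_I2)
      fix z :: "(real^'d) \<times> real"
      obtain x t where z: "z = (x, t)" by (cases z)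
      show "norm (if norm (fst z) < snd z then p z * weight \<beta> \<mu> z else 0)
        \<le> norm (if norm (fst z) < snd z then G z * h (snd z) else 0)"
      proof (cases "norm x < t")
        case True
        then have "t > 0" by (rule le_less_trans[OF norm_ge_zero])
        have "\<bar>p (x, t)\<bar> * weight \<beta> \<mu> (x, t) \<le> (C * (1 + t) ^ N) * weight \<beta> \<mu> (x, t)"
          using C(2)[OF True] by (intro mult_right_mono) (auto simp: weight_def)
        also have "\<dots> = G (x, t) * h t" by (simp add: G_def h_def weight_def)
        finally have "\<bar>p (x, t)\<bar> * weight \<beta> \<mu> (x, t) \<le> G (x, t) * h t" .
        moreover have "\<bar>p (x, t) * weight \<beta> \<mu> (x, t)\<bar> = \<bar>p (x, t)\<bar> * weight \<beta> \<mu> (x, t)"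
          by (simp add: abs_mult weight_def)
        moreover have "\<bar>G (x, t) * h t\<bar> = G (x, t) * h t"
          using C(1) \<open>t > 0\<close> by (intro abs_of_nonneg) (simp add: G_def h_def)
        ultimately show ?thesis using True by (simp add: z)
      qed (simp add: z)
    qed
  qed
qed

text \<open>In the factorization, \<open>G\<close> collects the factors homogeneous in (x, t) and
  \<open>h\<close> those depending on \<open>t\<close> alone, among them t^j.\<close>

lemma cone_inner_cone_poly_monomial:
  fixes k a :: "'d::finite \<Rightarrow> nat" and n :: nat
  assumes \<mu>: "\<mu> > -1/2" and \<beta>: "2 * \<mu> + \<beta> + real CARD('d) > 0"
  defines "A \<equiv> real n + real (mdeg k) + \<beta> + 2 * \<mu> + real CARD('d) - 1"
  shows "cone_inner \<beta> \<mu> (cone_poly \<beta> \<mu> k n) (monomial_fun a j) =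
    ball_moment (real (mdeg k) + \<mu> - 1/2) (coord_word k) a *
    gamma_moment (real (mdeg k) + real (mdeg a) + 2 * \<mu> - 1 + real CARD('d) + \<beta> + real j) (laguerre_poly A (n - mdeg k))"
proof -
  define R where "R = rodrigues (real (mdeg k) + \<mu> - 1/2) (coord_word k)"
  define G where "G = (\<lambda>z::(real^'d) \<times> real. R z * monomial_fun a 0 z * ((snd z)\<^sup>2 - (norm (fst z))\<^sup>2) powr (\<mu> - 1/2))"
  define q where "q = laguerre_poly A (n - mdeg k)"
  define h where "h = (\<lambda>t::real. poly q t * t ^ j * t powr \<beta> * exp (- t))"
  \<comment> \<open>The degree of homogeneity of \<open>G\<close>: |k| from the Rodrigues factor,
    |a| from the monomial, 2 (\<mu> - 1/2) from the weight.\<close>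
  define s where "s = real (mdeg k) + real (mdeg a) + 2 * \<mu> - 1"
  have R: "R \<in> homog_polys (mdeg k)"
    unfolding R_def length_coord_word[of k, symmetric] by (rule rodrigues_homog)
  have m: "monomial_fun a 0 \<in> homog_polys (mdeg a)" by (rule monomial_fun_homog) simp
  have cont: "continuous_on UNIV p" if "p \<in> homog_polys i" for p :: "(real^'d) \<times> real \<Rightarrow> real" and i
    using continuous_on_polymonial_function[OF real_polynomial_function_homog[OF that, unfolded real_polynomial_function_eq]] .
  have [measurable]: "R \<in> borel_measurable borel" "monomial_fun a 0 \<in> borel_measurable borel"
    by (intro borel_measurable_continuous_onI cont[OF R] cont[OF m])+
  have ball: "(\<lambda>y::real^'d. indicator (ball 0 1) y * G (y, 1)) = (\<lambda>y. indicator (ball 0 1) y * (R (y, 1) * monomial_fun a 0 (y, 1) *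
     (1 - (norm y)\<^sup>2) powr (real (mdeg k) + \<mu> - 1/2 - real (length (coord_word k)))))"
    by (simp add: G_def length_coord_word)
  have gam: "indicator {0<..} t * (t powr (s + real DIM(real^'d)) * h t) =
     indicator {0<..} t * (t powr (s + real CARD('d) + \<beta> + real j) * (poly q t * exp (- t)))" for t
    by (simp add: h_def powr_add powr_realpow indicator_def)
  have "cone_inner \<beta> \<mu> (cone_poly \<beta> \<mu> k n) (monomial_fun a j) =
     (\<integral>z. (if norm (fst z) < snd z then G z * h (snd z) else 0) \<partial>lborel)"
    unfolding cone_inner_altdef
    by (intro Bochner_Integration.integral_cong refl)
      (auto simp: cone_poly_def R_def[symmetric] A_def[symmetric] q_def[symmetric] G_def h_def weight_def monomial_fun_apply)
  also have "\<dots> = (\<integral>y. indicator (ball (0::real^'d) 1) y * G (y, 1) \<partial>lborel) *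
      (\<integral>t. indicator {0<..} t * (t powr (s + real DIM(real^'d)) * h t) \<partial>lborel)"
  proof (rule cone_integral_factor(2))
    show "G \<in> borel_measurable borel" unfolding G_def by measurable
    have [measurable]: "poly q \<in> borel_measurable borel"
      by (intro borel_measurable_continuous_onI continuous_intros)
    show "h \<in> borel_measurable borel" unfolding h_def by measurable
    show "G (t *\<^sub>R y, t) = t powr s * G (y, 1)" if "t > 0" "norm y < 1" for t y
    proof -
      have "R (t *\<^sub>R y, t) = t ^ mdeg k * R (y, 1)" "monomial_fun a 0 (t *\<^sub>R y, t) = t ^ mdeg a * monomial_fun a 0 (y, 1)"
        using homog_polys_scaleR[OF R, of t y 1] homog_polys_scaleR[OF m, of t y 1] by simp_all
      moreover have "t powr s = t ^ mdeg k * t ^ mdeg a * t powr (2 * (\<mu> - 1/2))"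
        using that by (simp add: s_def powr_realpow[symmetric] powr_add[symmetric] algebra_simps)
      ultimately show ?thesis
        using quad_powr_scaleR[OF that] by (simp add: G_def)
    qed
    show "integrable lborel (\<lambda>y::real^'d. indicator (ball 0 1) y * G (y, 1))"
      unfolding ball R_def using \<mu> by (intro integrable_ball_moment) (simp add: length_coord_word)
    show "integrable lborel (\<lambda>t. indicator {0<..} t * (t powr (s + real DIM(real^'d)) * h t))"
      unfolding gam using \<beta> by (intro integrable_gamma_moment) (simp add: s_def)
  qed
  also have "\<dots> = ball_moment (real (mdeg k) + \<mu> - 1/2) (coord_word k) a * gamma_moment (s + real CARD('d) + \<beta> + real j) q"
    unfolding ball gam ball_moment_def gamma_moment_def R_def ..
  finally show ?thesis by (simp add: s_def q_def)
qed

section \<open>Triangularity\<close>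

context
  fixes \<beta> \<mu> :: real
  assumes \<mu>: "\<mu> > -1/2" and \<beta>: "2 * \<mu> + \<beta> + real CARD('d::finite) > 0"
begin

private abbreviation "ip \<equiv> cone_inner \<beta> \<mu> :: ((real^'d) \<times> real \<Rightarrow> real) \<Rightarrow> ((real^'d) \<times> real \<Rightarrow> real) \<Rightarrow> real"

lemma integrable_cone_inner:
  fixes p q :: "(real^'d) \<times> real \<Rightarrow> real"
  assumes "real_polynomial_function p" "real_polynomial_function q"
  shows "integrable lborel (\<lambda>z. if norm (fst z) < snd z then p z * q z * weight \<beta> \<mu> z else 0)"
  using integrable_polynomial_weight[OF \<mu> \<beta> real_polynomial_function.intros(4)[OF assms]] .

lemma cone_inner_sum:
  fixes g :: "(real^'d) \<times> real \<Rightarrow> real"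
  assumes "finite I" "\<And>i. i \<in> I \<Longrightarrow> real_polynomial_function (p i)" "real_polynomial_function g"
  shows "ip (\<lambda>z. \<Sum>i\<in>I. c i * p i z) g = (\<Sum>i\<in>I. c i * ip (p i) g)"
proof -
  have "ip (\<lambda>z. \<Sum>i\<in>I. c i * p i z) g =
     (\<integral>z. (\<Sum>i\<in>I. c i * (if norm (fst z) < snd z then p i z * g z * weight \<beta> \<mu> z else 0)) \<partial>lborel)"
    unfolding cone_inner_altdef
    by (intro Bochner_Integration.integral_cong refl) (simp add: sum_distrib_right mult.assoc)
  also have "\<dots> = (\<Sum>i\<in>I. c i * ip (p i) g)"
    unfolding cone_inner_altdef using assms
    by (subst Bochner_Integration.integral_sum) (auto intro: integrable_cone_inner)
  finally show ?thesis .
qed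

lemma cone_inner_add:
  fixes p q g :: "(real^'d) \<times> real \<Rightarrow> real"
  assumes "real_polynomial_function p" "real_polynomial_function q" "real_polynomial_function g"
  shows "ip (p + q) g = ip p g + ip q g"
  using cone_inner_sum[of "UNIV :: bool set" "\<lambda>b. if b then p else q" g "\<lambda>_. 1"] assms
  by (simp add: UNIV_bool plus_fun_def add.commute)

lemma cone_inner_scale: "ip (\<lambda>z. c * p z) g = c * ip p g"
proof -
  have "ip (\<lambda>z. c * p z) g = (\<integral>z. c * (if norm (fst z) < snd z then p z * g z * weight \<beta> \<mu> z else 0) \<partial>lborel)"
    unfolding cone_inner_altdef by (intro Bochner_Integration.integral_cong refl) auto
  then show ?thesis by (simp add: cone_inner_altdef)
qed

lemma cone_inner_0: "ip (\<lambda>z. 0) g = 0"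
  using cone_inner_scale[of 0 "\<lambda>z. 0" g] by simp

lemma cone_inner_commute: "ip p q = ip q p"
  unfolding cone_inner_altdef by (simp add: mult.commute cong: if_cong)

lemma cone_inner_diff:
  fixes p q g :: "(real^'d) \<times> real \<Rightarrow> real"
  assumes "real_polynomial_function p" "real_polynomial_function q" "real_polynomial_function g"
  shows "ip (p - q) g = ip p g - ip q g"
proof -
  have "real_polynomial_function (p - q)"
    using assms by (simp add: fun_diff_def real_polynomial_function_diff)
  from cone_inner_add[OF this assms(2,3)] show ?thesis by simp
qed

lemma cone_inner_polys_deg_le_eq_0:
  fixes p q :: "(real^'d) \<times> real \<Rightarrow> real"
  assumes p: "real_polynomial_function p" and q: "q \<in> polys_deg_le n"
    and 0: "\<And>a j. mdeg a + j \<le> n \<Longrightarrow> ip p (monomial_fun a j) = 0"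
  shows "ip p q = 0"
proof -
  \<comment> \<open>Polynomiality is carried along because additivity of the integral needs
    integrable terms.\<close>
  have "real_polynomial_function q \<and> ip q p = 0"
    using q unfolding polys_deg_le_def
  proof (induction rule: fun_space.span_induct_alt)
    case base
    then show ?case
      by (simp add: zero_fun_def real_polynomial_function.intros(2) cone_inner_0)
  next
    case (step c x y)
    then obtain a j where x: "x = monomial_fun a j" "mdeg a + j \<le> n" by blast
    have "real_polynomial_function (\<lambda>z. c * x z)"
      using x by (auto intro!: real_polynomial_function.intros(2,4) real_polynomial_function_monomial_fun)
    then have "real_polynomial_function (\<lambda>z. c * x z + y z)" "ip (\<lambda>z. c * x z + y z) p = c * ip x p + ip y p"
      using step p cone_inner_add[of "\<lambda>z. c * x z" y p] real_polynomial_function.intros(3)[of "\<lambda>z. c * x z" y]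
      unfolding plus_fun_def by (simp_all only: cone_inner_scale simp_thms)
    then show ?case
      using x step 0[OF x(2)] unfolding plus_fun_def by (simp add: cone_inner_commute[of _ p])
  qed
  then show ?thesis by (simp add: cone_inner_commute)
qed

text \<open>The weight is positive inside the cone, so \<open>p\<close> vanishes almost everywhere
  there. The set where it does not is open and null, hence empty, and a polynomial vanishing on a
  nonempty open set is zero.\<close>

lemma cone_inner_self_eq_0:
  fixes p :: "(real^'d) \<times> real \<Rightarrow> real"
  assumes p: "real_polynomial_function p" and 0: "ip p p = 0"
  shows "p = (\<lambda>z. 0)"
proof -
  let ?S = "{z::(real^'d) \<times> real. norm (fst z) < snd z}"
  let ?f = "\<lambda>z. if norm (fst z) < snd z then p z * p z * weight \<beta> \<mu> z else 0"
  have W: "weight \<beta> \<mu> z > 0" if "z \<in> ?S" for z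
  proof -
    obtain x t where z: "z = (x, t)" by (cases z)
    have "norm x < t" "t > 0" using that z le_less_trans[OF norm_ge_zero, of x t] by auto
    then show ?thesis by (simp add: z weight_def power_strict_mono)
  qed
  have cont: "continuous_on UNIV p"
    using p by (intro continuous_on_polymonial_function) (simp add: real_polynomial_function_eq)
  have "AE z in lborel. 0 \<le> ?f z"
    by (intro AE_I2) (auto intro!: mult_nonneg_nonneg[OF zero_le_square] less_imp_le[OF W])
  moreover have "integral\<^sup>L lborel ?f = 0" using 0 by (simp add: cone_inner_altdef)
  ultimately have "AE z in lborel. ?f z = 0"
    using integral_nonneg_eq_0_iff_AE[OF integrable_cone_inner[OF p p]] by blast
  then have "AE z in lborel. z \<notin> ?S \<inter> {z. p z \<noteq> 0}"
  proof eventually_elim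
    case (elim z)
    then show ?case using W[of z] by (auto split: if_splits)
  qed
  moreover have opn: "open (?S \<inter> {z. p z \<noteq> 0})"
    using cont by (intro open_Int open_cone_interior open_Collect_neq continuous_on_const)
  ultimately have "?S \<inter> {z. p z \<noteq> 0} \<in> null_sets lborel"
    by (subst AE_iff_null_sets) auto
  then have "negligible (?S \<inter> {z. p z \<noteq> 0})"
    by (simp add: negligible_iff_null_sets null_sets_completionI)
  then have "?S \<inter> {z. p z \<noteq> 0} = {}"
    using open_not_negligible[OF opn] by blast
  then show ?thesis
    by (intro real_polynomial_function_eq_0[OF p open_cone_interior, of "(0, 1)"]) auto
qed

lemma cone_poly_orth_monomial:
  fixes k a :: "'d \<Rightarrow> nat"
  assumes k: "mdeg k \<le> n" and a: "mdeg a + j < n"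
  shows "ip (cone_poly \<beta> \<mu> k n) (monomial_fun a j) = 0"
proof (cases "\<exists>l. a l < k l")
  case True
  then obtain l where "a l < count_list (coord_word k) l" by (auto simp: count_list_coord_word)
  then have "ball_moment (real (mdeg k) + \<mu> - 1/2) (coord_word k) a = 0"
    using \<mu> by (intro ball_moment_eq_0) (auto simp: length_coord_word)
  then show ?thesis by (simp add: cone_inner_cone_poly_monomial[OF \<mu> \<beta>])
next
  case False
  then have "mdeg k \<le> mdeg a" by (intro mdeg_mono) (simp add: not_less)
  define A where "A = real n + real (mdeg k) + \<beta> + 2 * \<mu> + real CARD('d) - 1"
  \<comment> \<open>The excess \<open>mdeg a + j - mdeg k\<close> is a genuine difference here and
    lies below \<open>n - mdeg k\<close>, so the corresponding power of \<open>t\<close> is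
    orthogonal to the Laguerre factor.\<close>
  have "gamma_moment (A - real (n - mdeg k) + real (mdeg a + j - mdeg k)) (laguerre_poly A (n - mdeg k)) = 0"
    using k a \<beta> \<open>mdeg k \<le> mdeg a\<close>
    by (intro gamma_moment_laguerre_eq_0) (auto simp: A_def of_nat_diff)
  moreover have "A - real (n - mdeg k) + real (mdeg a + j - mdeg k) =
      real (mdeg k) + real (mdeg a) + 2 * \<mu> - 1 + real CARD('d) + \<beta> + real j"
    using k \<open>mdeg k \<le> mdeg a\<close> by (simp add: A_def of_nat_diff)
  ultimately show ?thesis
    by (simp add: cone_inner_cone_poly_monomial[OF \<mu> \<beta>] A_def[symmetric])
qed

lemma cone_poly_orth_polys:
  fixes k :: "'d \<Rightarrow> nat"
  assumes "mdeg k \<le> n"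
  shows "cone_poly \<beta> \<mu> k n \<in> orth_polys \<beta> \<mu> n"
proof -
  have "ip (cone_poly \<beta> \<mu> k n) q = 0" if "m < n" "q \<in> polys_deg_le m" for m q
    by (rule cone_inner_polys_deg_le_eq_0[OF real_polynomial_function_cone_poly[OF assms] that(2)])
      (rule cone_poly_orth_monomial[OF assms], use that(1) in simp)
  then show ?thesis
    using cone_poly_polys_deg_le[OF assms] by (simp add: orth_polys_def)
qed

text \<open>Monomials of degree exactly \<open>n\<close> are indexed by the exponent of
  \<open>x\<close> alone; for |a| <= n the power of \<open>t\<close> makes up the
  difference.\<close>

private abbreviation "top_moment n a p \<equiv> ip p (monomial_fun a (n - mdeg a))"

text \<open>The ball factor alone vanishes. Equal degrees are included, so the matrix of these
  moments is diagonal within each degree.\<close>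

lemma top_moment_eq_0:
  fixes k a :: "'d \<Rightarrow> nat"
  assumes "mdeg a \<le> mdeg k" "a \<noteq> k"
  shows "top_moment n a (cone_poly \<beta> \<mu> k n) = 0"
proof -
  obtain l where "a l < count_list (coord_word k) l"
    using ex_less_of_mdeg_le[OF assms] by (auto simp: count_list_coord_word)
  then have "ball_moment (real (mdeg k) + \<mu> - 1/2) (coord_word k) a = 0"
    using \<mu> by (intro ball_moment_eq_0) (auto simp: length_coord_word)
  then show ?thesis by (simp add: cone_inner_cone_poly_monomial[OF \<mu> \<beta>])
qed

lemma top_moment_neq_0:
  fixes k :: "'d \<Rightarrow> nat"
  assumes k: "mdeg k \<le> n"
  shows "top_moment n k (cone_poly \<beta> \<mu> k n) \<noteq> 0"
proof -
  define A where "A = real n + real (mdeg k) + \<beta> + 2 * \<mu> + real CARD('d) - 1"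
  have "ball_moment (real (mdeg k) + \<mu> - 1/2) (coord_word k) k \<noteq> 0"
    using ball_moment_neq_0[of "real (mdeg k) + \<mu> - 1/2" "coord_word k"] \<mu>
    by (simp add: length_coord_word count_list_coord_word)
  moreover have "gamma_moment A (laguerre_poly A (n - mdeg k)) \<noteq> 0"
    using k \<beta> by (intro gamma_moment_laguerre_neq_0) (auto simp: A_def of_nat_diff)
  \<comment> \<open>For \<open>a = k\<close> the moment parameter is \<open>A\<close> itself, the
    borderline nonvanishing case.\<close>
  moreover have "real (mdeg k) + real (mdeg k) + 2 * \<mu> - 1 + real CARD('d) + \<beta> + real (n - mdeg k) = A"
    using k by (simp add: A_def of_nat_diff)
  ultimately show ?thesis
    by (simp add: cone_inner_cone_poly_monomial[OF \<mu> \<beta>] A_def[symmetric])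
qed

text \<open>Of two members with distinct indices, pairing with the top monomial of the index of
  smaller or equal degree annihilates one but not the other. Independence is stated for the image
  set; injectivity carries it over to the family.\<close>

lemma inj_on_cone_poly: "inj_on (\<lambda>k::'d \<Rightarrow> nat. cone_poly \<beta> \<mu> k n) {k. mdeg k \<le> n}"
proof (rule inj_onI, rule ccontr)
  fix k l :: "'d \<Rightarrow> nat"
  assume kl: "k \<in> {k. mdeg k \<le> n}" "l \<in> {k. mdeg k \<le> n}" "cone_poly \<beta> \<mu> k n = cone_poly \<beta> \<mu> l n" "k \<noteq> l"
  then show False
    using top_moment_eq_0[of k l n] top_moment_eq_0[of l k n] top_moment_neq_0[of k n] top_moment_neq_0[of l n]
    by (cases "mdeg k \<le> mdeg l") auto
qed

lemma independent_cone_poly: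
  "fun_space.independent ((\<lambda>k::'d \<Rightarrow> nat. cone_poly \<beta> \<mu> k n) ` {k. mdeg k \<le> n})"
proof -
  let ?K = "{k::'d \<Rightarrow> nat. mdeg k \<le> n}" and ?U = "\<lambda>k::'d \<Rightarrow> nat. cone_poly \<beta> \<mu> k n"
  have "u v = 0" if u: "(\<Sum>v\<in>?U ` ?K. (\<lambda>z. u v * v z)) = 0" and v: "v \<in> ?U ` ?K" for u v
  proof -
    have "0 = (\<Sum>k\<in>?K. (\<lambda>z. u (?U k) * ?U k z))"
      using u by (subst (asm) sum.reindex[OF inj_on_cone_poly]) (simp add: o_def)
    then have zero: "(\<lambda>z. \<Sum>k\<in>?K. u (?U k) * ?U k z) = (\<lambda>z. 0)"
      by (simp add: sum_fun_eq zero_fun_def)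
    have "u (?U k) = 0" if "k \<in> ?K" for k
      using that
    \<comment> \<open>Pairing the relation with the top monomial of \<open>k\<close> removes indices
      of lower degree by the induction hypothesis and all others by the vanishing moments, leaving
      the diagonal term.\<close>
    proof (induction "mdeg k" arbitrary: k rule: less_induct)
      case less
      have "0 = top_moment n k (\<lambda>z. \<Sum>k\<in>?K. u (?U k) * ?U k z)"
        unfolding zero by (simp add: cone_inner_0)
      also have "\<dots> = (\<Sum>l\<in>?K. u (?U l) * top_moment n k (?U l))"
        by (intro cone_inner_sum finite_mdeg_le real_polynomial_function_monomial_fun)
          (simp add: real_polynomial_function_cone_poly)
      also have "\<dots> = (\<Sum>l\<in>?K. if l = k then u (?U k) * top_moment n k (?U k) else 0)"
        using less.hyps top_moment_eq_0[of k _ n]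
        by (intro sum.cong refl) (auto simp: not_less[symmetric])
      also have "\<dots> = u (?U k) * top_moment n k (?U k)"
        using less.prems by (subst sum.delta[OF finite_mdeg_le]) simp
      finally show ?case using top_moment_neq_0[of k n] less.prems by simp
    qed
    then show ?thesis using v by blast
  qed
  then show ?thesis
    using fun_space.dependent_finite[of "?U ` ?K"] finite_mdeg_le by blast
qed

lemma subspace_orth_polys: "fun_space.subspace (orth_polys \<beta> \<mu> n :: ((real^'d) \<times> real \<Rightarrow> real) set)"
proof (rule fun_space.subspaceI)
  show "0 \<in> (orth_polys \<beta> \<mu> n :: ((real^'d) \<times> real \<Rightarrow> real) set)"
    using fun_space.span_zero
    by (auto simp: orth_polys_def polys_deg_le_def zero_fun_def cone_inner_0)
next
  fix p q :: "(real^'d) \<times> real \<Rightarrow> real"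
  assume p: "p \<in> orth_polys \<beta> \<mu> n" and q: "q \<in> orth_polys \<beta> \<mu> n"
  then have "p + q \<in> polys_deg_le n"
    by (simp add: orth_polys_def polys_deg_le_def fun_space.span_add)
  then show "p + q \<in> orth_polys \<beta> \<mu> n"
    using p q by (auto simp: orth_polys_def cone_inner_add polys_deg_le_real_polynomial)
next
  fix c and p :: "(real^'d) \<times> real \<Rightarrow> real"
  assume p: "p \<in> orth_polys \<beta> \<mu> n"
  then have "(\<lambda>z. c * p z) \<in> polys_deg_le n"
    by (simp add: orth_polys_def polys_deg_le_def fun_space.span_scale)
  then show "(\<lambda>z. c * p z) \<in> orth_polys \<beta> \<mu> n"
    using p by (auto simp: orth_polys_def cone_inner_scale)
qed

lemma span_cone_poly:
  "fun_space.span ((\<lambda>k::'d \<Rightarrow> nat. cone_poly \<beta> \<mu> k n) ` {k. mdeg k \<le> n}) = orth_polys \<beta> \<mu> n"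
proof
  let ?K = "{k::'d \<Rightarrow> nat. mdeg k \<le> n}" and ?U = "\<lambda>k::'d \<Rightarrow> nat. cone_poly \<beta> \<mu> k n"
  show sub: "fun_space.span (?U ` ?K) \<subseteq> orth_polys \<beta> \<mu> n"
    by (intro fun_space.span_minimal subspace_orth_polys) (auto intro: cone_poly_orth_polys)
  show "orth_polys \<beta> \<mu> n \<subseteq> fun_space.span (?U ` ?K)"
  proof
    fix p :: "(real^'d) \<times> real \<Rightarrow> real" assume p: "p \<in> orth_polys \<beta> \<mu> n"
    have rp: "real_polynomial_function q" if "q \<in> orth_polys \<beta> \<mu> n" for q :: "(real^'d) \<times> real \<Rightarrow> real"
      using that by (auto simp: orth_polys_def polys_deg_le_real_polynomial)
    \<comment> \<open>Elimination by degree: \<open>u\<close> is corrected one level at a time, each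
      level clearing the top moments at the indices of one more degree.\<close>
    have "\<exists>u \<in> fun_space.span (?U ` ?K). \<forall>a\<in>?K. mdeg a < l \<longrightarrow> top_moment n a (p - u) = 0" for l
    proof (induction l)
      case 0
      then show ?case using fun_space.span_zero by blast
    next
      case (Suc l)
      then obtain u where u: "u \<in> fun_space.span (?U ` ?K)"
        "\<And>a. a \<in> ?K \<Longrightarrow> mdeg a < l \<Longrightarrow> top_moment n a (p - u) = 0" by blast
      define I where "I = {k \<in> ?K. mdeg k = l}"
      \<comment> \<open>The diagonal moment is nonzero, so this quotient cancels the top moment of
        \<open>p - u\<close> at \<open>k\<close>. Members of degree \<open>l\<close> contribute
        nothing at other indices of degree at most \<open>l\<close>, so earlier levels stay
        cancelled.\<close>
      define c where "c = (\<lambda>k. top_moment n k (p - u) / top_moment n k (?U k))"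
      define w where "w = (\<lambda>z. \<Sum>k\<in>I. c k * ?U k z)"
      have finI: "finite I" by (rule finite_subset[OF _ finite_mdeg_le[of n]]) (auto simp: I_def)
      have w: "w \<in> fun_space.span (?U ` ?K)"
      proof -
        have "(\<Sum>k\<in>I. (\<lambda>z. c k * ?U k z)) \<in> fun_space.span (?U ` ?K)"
          by (intro fun_space.span_sum fun_space.span_scale fun_space.span_base) (auto simp: I_def)
        then show ?thesis by (simp add: w_def sum_fun_eq)
      qed
      have "top_moment n a (p - (u + w)) = 0" if a: "a \<in> ?K" "mdeg a < Suc l" for a
      proof -
        have pu: "p - u \<in> orth_polys \<beta> \<mu> n"
          using fun_space.subspace_diff[OF subspace_orth_polys p] u(1) sub by blast
        have 1: "top_moment n a (p - (u + w)) = top_moment n a (p - u) - top_moment n a w"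
          using cone_inner_diff[OF rp[OF pu] rp[of w] real_polynomial_function_monomial_fun] w sub
          by (simp add: diff_diff_eq subset_eq)
        have "top_moment n a w = (\<Sum>k\<in>I. c k * top_moment n a (?U k))"
          unfolding w_def
          by (intro cone_inner_sum finI real_polynomial_function_monomial_fun)
            (simp add: I_def real_polynomial_function_cone_poly)
        also have "\<dots> = (\<Sum>k\<in>I. if k = a then c a * top_moment n a (?U a) else 0)"
          using a top_moment_eq_0[of a _ n] by (intro sum.cong refl) (auto simp: I_def)
        also have "\<dots> = (if a \<in> I then top_moment n a (p - u) else 0)"
          using finI top_moment_neq_0[of a n] a(1) by (simp add: sum.delta c_def)
        finally have 2: "top_moment n a w = (if a \<in> I then top_moment n a (p - u) else 0)" .
        show ?thesis unfolding 1 2 using a u(2)[of a] by (auto simp: I_def)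
      qed
      then show ?case using fun_space.span_add[OF u(1) w] by blast
    qed
    then obtain u where u: "u \<in> fun_space.span (?U ` ?K)"
      "\<And>a. a \<in> ?K \<Longrightarrow> mdeg a < Suc n \<Longrightarrow> top_moment n a (p - u) = 0" by blast
    have pu: "p - u \<in> orth_polys \<beta> \<mu> n"
      using fun_space.subspace_diff[OF subspace_orth_polys p] u(1) sub by blast
    \<comment> \<open>Monomials of degree \<open>n\<close> are covered by the elimination, those of
      smaller degree because \<open>p - u\<close> stays in the orthogonal space.\<close>
    have orth: "ip (p - u) (monomial_fun a j) = 0" if "mdeg a + j \<le> n" for a j
    proof (cases "mdeg a + j = n")
      case True
      then show ?thesis using u(2)[of a] by auto
    next
      case False
      then have "mdeg a + j < n" using that by simp
      then show ?thesis
        using pu monomial_fun_polys_deg_le[OF order.refl, of a j] unfolding orth_polys_def by blast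
    qed
    have "p - u \<in> polys_deg_le n" using pu by (simp add: orth_polys_def)
    \<comment> \<open>The difference is itself a polynomial of degree at most \<open>n\<close>,
      hence orthogonal to itself.\<close>
    from cone_inner_polys_deg_le_eq_0[OF rp[OF pu] this orth]
    have "ip (p - u) (p - u) = 0" .
    then have "p - u = (\<lambda>z. 0)" by (intro cone_inner_self_eq_0 rp pu)
    then have "p = u" by (simp add: fun_eq_iff)
    then show "p \<in> fun_space.span (?U ` ?K)" using u(1) by simp
  qed
qed

end

theorem theorem4p2:
  fixes \<beta> \<mu> :: real and n :: nat
    and U :: "('d::finite \<Rightarrow> nat) \<Rightarrow> (real^'d) \<times> real \<Rightarrow> real"
    and K :: "('d \<Rightarrow> nat) set"
  defines "U \<equiv> \<lambda>k. UL \<beta> \<mu> k n"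
    and "K \<equiv> {k. mdeg k \<le> n}"
  assumes "\<mu> > -1/2" and "\<beta> > - real CARD('d)" and "2 * \<mu> + \<beta> + real CARD('d) > 0"
  shows "(\<forall>k\<in>K. is_UL \<beta> \<mu> k n (U k))
    \<and> inj_on U K
    \<and> fun_space.independent (U ` K)
    \<and> fun_space.span (U ` K) = orth_polys \<beta> \<mu> n"
proof -
  have U: "U k = cone_poly \<beta> \<mu> k n" if "k \<in> K" for k
    using that by (simp add: U_def K_def UL_eq_cone_poly)
  have img: "U ` K = (\<lambda>k. cone_poly \<beta> \<mu> k n) ` {k. mdeg k \<le> n}"
    using U by (auto simp: K_def)
  have "\<forall>k\<in>K. is_UL \<beta> \<mu> k n (U k)"
    using U by (auto simp: K_def is_UL_cone_poly)
  moreover have "inj_on U K"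
    using inj_on_cong[of K U, OF U] inj_on_cone_poly[OF assms(3,5), of n] by (simp add: K_def)
  ultimately show ?thesis
    unfolding img using independent_cone_poly[OF assms(3,5)] span_cone_poly[OF assms(3,5)] by blast
qed

end
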